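(* Let $\Omega=\mathbb{H}$ be the open upper half-plane or $\Omega=\mathbb{D}$ be the open unit disk, let $N\ge 1$ and let $a_1,\dots,a_N\in\mathbb{R}$ satisfy $a_i>0$ for every $i\in\{1,\dots,N\}$. Then for every family $(x_i^0)_{1\le i\le N}$ of pairwise distinct points of $\Omega$, the point-vortex system in $\Omega$ with intensities $a_1,\dots,a_N$ and initial positions $x_i(0)=x_i^0$, namely $$\frac{\mathrm{d}}{\mathrm{d}t}x_i(t)=\sum_{\substack{j=1\\ j\ne i}}^N a_j\,\nabla_x^\perp G_\Omega(x_i(t),x_j(t))+\frac{a_i}{2}\nabla^\perp\widetilde\gamma_\Omega(x_i(t)),\qquad i\in\{1,\dots,N\},$$ has a global solution, i.e. a solution defined for all $t\in[0,+\infty)$ (with the $x_i(t)$ pairwise distinct points of $\Omega$ for all $t$).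
   Context: For $x=(x_1,x_2)\in\mathbb{R}^2$ write $x^\perp=(-x_2,x_1)$, $\nabla^\perp=(-\partial_2,\partial_1)$, and $\bar x=(x_1,-x_2)$. $\nabla_x^\perp G(x,y)$ means that the derivatives are taken in the first variable. $\mathbb{H}=\{(x_1,x_2)\in\mathbb{R}^2: x_2>0\}$ and $\mathbb{D}=\{x\in\mathbb{R}^2:|x|<1\}$. $G_\Omega$ is the Green's function of the Laplacian with Dirichlet condition ($\Delta_xG_\Omega(\cdot,y)=\delta_y$, $G_\Omega(\cdot,y)=0$ on $\partial\Omega$), $\gamma_\Omega(x,y)=G_\Omega(x,y)-\frac1{2\pi}\ln|x-y|$ (extended smoothly to the diagonal), and $\widetilde\gamma_\Omega(x)=\gamma_\Omega(x,x)$ is the Robin's function. Explicitly, $$G_{\mathbb{H}}(x,y)=\frac1{2\pi}\ln\frac{|x-y|}{|x-\bar y|},\qquad \widetilde\gamma_{\mathbb{H}}(x)=-\frac1{2\pi}\ln(2x_2),$$ $$G_{\mathbb{D}}(x,y)=\frac1{2\pi}\ln\frac{|x-y|}{|x\bar y-1|},\qquad \widetilde\gamma_{\mathbb{D}}(x)=-\frac1{2\pi}\ln(1-|x|^2),$$ where in the formula for $G_{\mathbb{D}}$ the product $x\bar y$ is the product of complex numbers. *)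

theory Defs
  imports "HOL-Analysis.Analysis"
begin

text \<open>
  The plane is identified with the type \<^typ>\<open>complex\<close>: the point with coordinates
  \<open>(x1, x2)\<close> is \<open>Complex x1 x2\<close>, and the reflection \<open>(x1, -x2)\<close> is \<^const>\<open>cnj\<close>.
\<close>

definition half_plane :: "complex set" where
  "half_plane = {x. Im x > 0}"

definition unit_disk :: "complex set" where
  "unit_disk = {x. norm x < 1}"

text \<open>
  The perpendicular gradient \<open>(-\<partial>\<^sub>2 f, \<partial>\<^sub>1 f)\<close>, built from the two partial derivatives.
\<close>

definition grad_perp :: "(complex \<Rightarrow> real) \<Rightarrow> complex \<Rightarrow> complex" where
  "grad_perp f x =
     Complex (- deriv (\<lambda>t. f (Complex (Re x) t)) (Im x))
             (deriv (\<lambda>s. f (Complex s (Im x))) (Re x))"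

text \<open>
  The Dirichlet Green's functions of the Laplacian, with the sign convention
  \<open>\<Delta> G(\<cdot>, y) = \<delta>\<^sub>y\<close>. On the half-plane the Dirichlet condition on the boundary line alone
  leaves multiples of \<open>Im x\<close> undetermined, so both functions are given by their
  explicit formulas. Values at \<open>x = y\<close> are meaningless.
\<close>

definition green_half_plane :: "complex \<Rightarrow> complex \<Rightarrow> real" where
  "green_half_plane x y = 1 / (2 * pi) * ln (norm (x - y) / norm (x - cnj y))"

definition green_disk :: "complex \<Rightarrow> complex \<Rightarrow> real" where
  "green_disk x y = 1 / (2 * pi) * ln (norm (x - y) / norm (x * cnj y - 1))"

text \<open>
  The regular part \<open>\<gamma>(x, y)\<close> of a Green's function, extended to the diagonal by its limit,
  and the Robin's function \<open>\<gamma>(x, x)\<close>.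
\<close>

definition regular_part :: "(complex \<Rightarrow> complex \<Rightarrow> real) \<Rightarrow> complex \<Rightarrow> complex \<Rightarrow> real" where
  "regular_part G x y =
     (if x = y then Lim (at y) (\<lambda>z. G z y - 1 / (2 * pi) * ln (norm (z - y)))
      else G x y - 1 / (2 * pi) * ln (norm (x - y)))"

definition robin :: "(complex \<Rightarrow> complex \<Rightarrow> real) \<Rightarrow> complex \<Rightarrow> real" where
  "robin G x = regular_part G x x"

text \<open>
  \<open>x\<close> solves the point-vortex system on the whole of \<open>[0, \<infinity>)\<close>; the derivative at time \<open>0\<close> is
  one-sided. Membership in \<open>\<Omega>\<close> and distinctness are part of the notion: outside of this
  regime the right-hand side has no meaning.
\<close>

definition global_point_vortex_solution ::
  "complex set \<Rightarrow> (complex \<Rightarrow> complex \<Rightarrow> real) \<Rightarrow> nat \<Rightarrow> (nat \<Rightarrow> real) \<Rightarrow> (nat \<Rightarrow> complex)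
     \<Rightarrow> (nat \<Rightarrow> real \<Rightarrow> complex) \<Rightarrow> bool" where
  "global_point_vortex_solution \<Omega> G N a x0 x \<longleftrightarrow>
     (\<forall>i\<in>{1..N}. x i 0 = x0 i) \<and>
     (\<forall>t\<ge>0. (\<forall>i\<in>{1..N}. x i t \<in> \<Omega>) \<and> inj_on (\<lambda>i. x i t) {1..N}) \<and>
     (\<forall>t\<ge>0. \<forall>i\<in>{1..N}.
        (x i has_vector_derivative
           (\<Sum>j\<in>{1..N} - {i}. a j *\<^sub>R grad_perp (\<lambda>z. G z (x j t)) (x i t))
           + (a i / 2) *\<^sub>R grad_perp (robin G) (x i t))
        (at t within {0..}))"

text \<open>Consistency of the definitions: boundary values and the explicit Robin's functions.\<close>

lemma green_half_plane_boundary: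
  assumes "Im x = 0"
  shows "green_half_plane x y = 0"
proof -
  have "x - cnj y = cnj (x - y)"
    using assms by (simp add: complex_eq_iff)
  then have "norm (x - cnj y) = norm (x - y)"
    by (simp del: complex_cnj_diff)
  then show ?thesis
    by (simp add: green_half_plane_def)
qed

lemma green_disk_boundary:
  assumes "norm x = 1"
  shows "green_disk x y = 0"
proof -
  have "x * cnj x = 1"
    using complex_norm_square[of x] assms by simp
  then have "x * cnj y - 1 = x * cnj (y - x)"
    by (simp add: algebra_simps)
  then have "norm (x * cnj y - 1) = norm (x - y)"
    using assms by (simp add: norm_mult norm_minus_commute del: complex_cnj_diff)
  then show ?thesis
    by (simp add: green_disk_def)
qed

lemma robin_eqI:
  assumes lim: "(g \<longlongrightarrow> L) (at x)"
    and ev: "\<forall>\<^sub>F z in at x. 0 < h z"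
    and G: "\<And>z. G z x = 1 / (2 * pi) * ln (norm (z - x) / h z)"
    and g: "\<And>z. g z = - 1 / (2 * pi) * ln (h z)"
  shows "robin G x = L"
proof -
  have "\<forall>\<^sub>F z in at x. g z = G z x - 1 / (2 * pi) * ln (norm (z - x))"
    using ev eventually_neq_at_within[of x x UNIV]
  proof eventually_elim
    case (elim z)
    then show ?case
      by (simp add: G g ln_div field_simps)
  qed
  then have "((\<lambda>z. G z x - 1 / (2 * pi) * ln (norm (z - x))) \<longlongrightarrow> L) (at x)"
    using lim by (simp add: filterlim_cong)
  then show ?thesis
    by (simp add: robin_def regular_part_def tendsto_Lim)
qed

lemma robin_half_plane:
  assumes "x \<in> half_plane"
  shows "robin green_half_plane x = - 1 / (2 * pi) * ln (2 * Im x)"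
proof -
  have pos: "Im x > 0"
    using assms by (simp add: half_plane_def)
  have n: "norm (x - cnj x) = 2 * Im x"
    using pos by (simp add: cmod_eq_Im)
  have "((\<lambda>z. norm (z - cnj x)) \<longlongrightarrow> norm (x - cnj x)) (at x)"
    by (intro tendsto_intros)
  then have h: "((\<lambda>z. norm (z - cnj x)) \<longlongrightarrow> 2 * Im x) (at x)"
    by (simp only: n)
  show ?thesis
  proof (rule robin_eqI[where h = "\<lambda>z. norm (z - cnj x)"])
    show "((\<lambda>z. - 1 / (2 * pi) * ln (norm (z - cnj x))) \<longlongrightarrow> - 1 / (2 * pi) * ln (2 * Im x)) (at x)"
      using pos by (intro tendsto_mult tendsto_const tendsto_ln h) auto
    show "\<forall>\<^sub>F z in at x. 0 < norm (z - cnj x)"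
      using order_tendstoD(1)[OF h, of 0] pos by simp
  qed (simp_all add: green_half_plane_def)
qed

lemma robin_disk:
  assumes "x \<in> unit_disk"
  shows "robin green_disk x = - 1 / (2 * pi) * ln (1 - (norm x)\<^sup>2)"
proof -
  have "norm x < 1"
    using assms by (simp add: unit_disk_def)
  then have pos: "1 - (norm x)\<^sup>2 > 0"
    using abs_square_less_1[of "norm x"] by simp
  have "x * cnj x - 1 = complex_of_real ((norm x)\<^sup>2 - 1)"
    by (simp only: complex_norm_square[symmetric] of_real_diff of_real_1)
  then have n: "norm (x * cnj x - 1) = 1 - (norm x)\<^sup>2"
    using pos by (simp only: norm_of_real)
  have "((\<lambda>z. norm (z * cnj x - 1)) \<longlongrightarrow> norm (x * cnj x - 1)) (at x)"
    by (intro tendsto_intros)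
  then have h: "((\<lambda>z. norm (z * cnj x - 1)) \<longlongrightarrow> 1 - (norm x)\<^sup>2) (at x)"
    by (simp only: n)
  show ?thesis
  proof (rule robin_eqI[where h = "\<lambda>z. norm (z * cnj x - 1)"])
    show "((\<lambda>z. - 1 / (2 * pi) * ln (norm (z * cnj x - 1))) \<longlongrightarrow> - 1 / (2 * pi) * ln (1 - (norm x)\<^sup>2)) (at x)"
      using pos by (intro tendsto_mult tendsto_const tendsto_ln h) auto
    show "\<forall>\<^sub>F z in at x. 0 < norm (z * cnj x - 1)"
      using order_tendstoD(1)[OF h, of 0] pos by simp
  qed (simp_all add: green_disk_def)
qed

end

theory Submission
  imports Defs "HOL-Probability.Discrete_Topology"
begin

text \<open>
  Both domains carry a height function \<open>s\<close>, positive exactly on the domain: \<open>s x = 2 * Im x\<close> for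
  the half-plane and \<open>s x = 1 - |x|\<^sup>2\<close> for the disk. In terms of it
  \<open>G x y = 1/(4 * pi) * ln (|x - y|\<^sup>2 / (|x - y|\<^sup>2 + s x * s y))\<close> and the Robin's function is
  \<open>- 1/(2 * pi) * ln (s x)\<close>, so that one argument covers both cases.
  
  By the Picard-Lindeloef theorem and a continuation argument
  (\<open>ode_global_solution_if_trapped\<close>), a global solution exists as soon as every solution on a
  bounded interval \<open>[0, T)\<close> keeps its heights and its mutual distances above a positive bound. The
  Hamiltonian alone does not give this bound: it tends to plus infinity when a vortex reaches the boundary
  and to minus infinity when two vortices collide, and the two effects could compensate. The point is
  therefore to exclude the boundary first (\<open>height_bounded_below\<close>).
  
  The heights change only through the interaction of pairs: vortex \<open>j\<close> raises vortex \<open>i\<close> at the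
  rate \<open>a j * flux (z i) (z j)\<close>, where \<open>flux\<close> is antisymmetric. Two facts follow. First, the
  impulse, the sum of \<open>a i * s (z i)\<close>, is conserved; as all \<open>a i\<close> are positive, the heights are
  bounded. Second, for every polynomial \<open>p\<close> the moment, the sum of \<open>a i * p (s (z i))\<close>, has a bounded
  derivative however close the vortices come to each other or to the boundary, because the difference
  \<open>p' (s (z i)) - p' (s (z j))\<close> produced by antisymmetry cancels the singularity of the flux.
  
  Suppose that some height comes arbitrarily close to \<open>0\<close> as \<open>t\<close> tends to \<open>T\<close>. Along a
  sequence of times all heights converge, say to the numbers \<open>c i\<close>. The moment of
  \<open>p \<sigma> = \<Prod>j. (\<sigma> - c j)\<^sup>2\<close> then tends to \<open>0\<close> along the sequence, and, having a bounded derivative,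
  it tends to \<open>0\<close> as \<open>t\<close> tends to \<open>T\<close>. So near time \<open>T\<close> all heights stay near the finite set of the
  \<open>c j\<close>, and the vortices split into a low group, whose heights tend to \<open>0\<close> along the sequence, and a
  high group at a distance from it. Interactions inside the low group do not change its impulse, and the flux
  coming from the high group is at most a constant times the height of the receiving vortex, so the impulse of
  the low group decays at most exponentially (\<open>low_group_impulse_bounded_below\<close>) and cannot tend
  to \<open>0\<close> in finite time. This is the contradiction.
  
  Once the heights are bounded below, the Robin part of the Hamiltonian is bounded above. All
  terms \<open>G\<close> are negative, so conservation of the Hamiltonian bounds each of them, and hence the distances, from
  below (\<open>distance_bounded_below\<close>).
\<close>

section \<open>Continuation of solutions of ordinary differential equations\<close>

definition ode_solution ::
  "('a::real_normed_vector \<Rightarrow> 'a) \<Rightarrow> 'a set \<Rightarrow> real set \<Rightarrow> (real \<Rightarrow> 'a) \<Rightarrow> bool" where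
  "ode_solution V U J x \<longleftrightarrow>
     (\<forall>t\<in>J. x t \<in> U \<and> (x has_vector_derivative V (x t)) (at t within J))"

text \<open>
  The existence time \<open>h\<close> depends only on the bounds \<open>M\<close> and \<open>L\<close> and on the radius \<open>r\<close>, which is
  what continuation needs. The fixed point is sought among bounded continuous functions on the whole
  real line, a complete space; the integral map is made constant outside \<open>[0, h]\<close> by clamping the
  time.
\<close>

lemma picard_lindelof_local:
  fixes V :: "'a::banach \<Rightarrow> 'a"
  assumes h: "0 < h" and r: "0 \<le> r" and hM: "h * M \<le> r" and hL: "h * L < 1"
    and bd: "\<And>y. y \<in> cball x0 r \<Longrightarrow> norm (V y) \<le> M"
    and lip: "L-lipschitz_on (cball x0 r) V"
  shows "\<exists>x. x 0 = x0 \<and> ode_solution V (cball x0 r) {0..h} x"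
proof -
  define S :: "(real \<Rightarrow>\<^sub>C 'a) set" where "S = PiC UNIV (\<lambda>_. cball x0 r)"
  define clamp where "clamp t = max 0 (min h t)" for t :: real
  define P where "P u t = x0 + integral {0..clamp t} (\<lambda>s. V (apply_bcontfun u s))"
    for u :: "real \<Rightarrow>\<^sub>C 'a" and t
  have clamp: "0 \<le> clamp t" "clamp t \<le> h" for t
    using h by (auto simp: clamp_def)
  have L0: "0 \<le> L"
    using lip by (rule lipschitz_on_nonneg)
  have SD: "apply_bcontfun u t \<in> cball x0 r" if "u \<in> S" for u t
    using that by (auto simp: S_def mem_PiC_iff)
  have cont: "continuous_on A (\<lambda>s. V (apply_bcontfun u s))" if "u \<in> S" for u A
    using lipschitz_on_continuous_on[OF lip] SD[OF that]
    by (auto intro!: continuous_on_compose2[of "cball x0 r" V])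
  have Pcont: "continuous_on UNIV (P u)" if "u \<in> S" for u
  proof -
    have "continuous_on {0..h} (\<lambda>t. integral {0..t} (\<lambda>s. V (apply_bcontfun u s)))"
      using cont[OF that] by (intro indefinite_integral_continuous_1 integrable_continuous_real)
    then have "continuous_on UNIV (\<lambda>t. integral {0..clamp t} (\<lambda>s. V (apply_bcontfun u s)))"
      by (rule continuous_on_compose2)
        (use clamp in \<open>auto simp: clamp_def[abs_def] intro!: continuous_intros\<close>)
    then show ?thesis
      unfolding P_def by (intro continuous_intros)
  qed
  have Pball: "P u t \<in> cball x0 r" if "u \<in> S" for u t
  proof -
    have "norm (integral {0..clamp t} (\<lambda>s. V (apply_bcontfun u s))) \<le> M * (clamp t - 0)"
      using cont[OF that] SD[OF that] bd clamp by (intro integral_bound) auto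
    also have "\<dots> \<le> M * h"
      using clamp[of t] bd[of x0] r by (intro mult_left_mono) (auto intro: order_trans[OF norm_ge_zero])
    finally show ?thesis
      using hM by (simp add: P_def dist_norm mult.commute)
  qed
  have Pb: "P u \<in> bcontfun" if "u \<in> S" for u
    using Pcont[OF that] Pball[OF that]
    by (auto simp: bcontfun_def intro!: bounded_subset[OF bounded_cball[of x0 r]])
  have PD: "apply_bcontfun (Bcontfun (P u)) = P u" if "u \<in> S" for u
    using Pb[OF that] by (simp add: Bcontfun_inverse)
  have "\<exists>!u\<in>S. Bcontfun (P u) = u"
  proof (rule Banach_fix)
    show "complete S"
      unfolding S_def complete_eq_closed by (intro closed_PiC) auto
    have "const_bcontfun x0 \<in> S"
      using r by (auto simp: S_def mem_PiC_iff const_bcontfun.rep_eq)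
    then show "S \<noteq> {}"
      by blast
    show "0 \<le> h * L" "h * L < 1"
      using h L0 hL by auto
    show "(\<lambda>u. Bcontfun (P u)) ` S \<subseteq> S"
      using PD Pball by (auto simp: S_def mem_PiC_iff)
    fix u v assume u: "u \<in> S" and v: "v \<in> S"
    show "dist (Bcontfun (P u)) (Bcontfun (P v)) \<le> h * L * dist u v"
    proof (rule dist_bound)
      fix t
      let ?w = "\<lambda>s. V (apply_bcontfun u s) - V (apply_bcontfun v s)"
      have "norm (integral {0..clamp t} ?w) \<le> (L * dist u v) * (clamp t - 0)"
      proof (intro integral_bound)
        fix s
        have "norm (?w s) \<le> L * dist (apply_bcontfun u s) (apply_bcontfun v s)"
          using lipschitz_onD[OF lip SD[OF u] SD[OF v]] by (simp add: dist_norm)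
        also have "\<dots> \<le> L * dist u v"
          using L0 by (intro mult_left_mono dist_bounded)
        finally show "norm (?w s) \<le> L * dist u v" .
      qed (use clamp cont[OF u] cont[OF v] in \<open>auto intro!: continuous_intros\<close>)
      also have "\<dots> \<le> (L * dist u v) * h"
        using clamp[of t] L0 by (intro mult_left_mono) auto
      also have "integral {0..clamp t} ?w = P u t - P v t"
        using cont[OF u] cont[OF v] unfolding P_def
        by (subst integral_diff) (auto intro!: integrable_continuous_real)
      finally show "dist (apply_bcontfun (Bcontfun (P u)) t) (apply_bcontfun (Bcontfun (P v)) t)
          \<le> h * L * dist u v"
        by (simp add: PD u v dist_norm mult_ac)
    qed
  qed
  then obtain u where u: "u \<in> S" and fp: "Bcontfun (P u) = u"
    by blast
  define x where "x = apply_bcontfun u"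
  have x: "x t = x0 + integral {0..clamp t} (\<lambda>s. V (x s))" for t
    using PD[OF u] fp by (metis P_def x_def)
  have "(x has_vector_derivative V (x t)) (at t within {0..h})" if t: "t \<in> {0..h}" for t
  proof -
    have "((\<lambda>t. x0 + integral {0..t} (\<lambda>s. V (x s))) has_vector_derivative 0 + V (x t)) (at t within {0..h})"
      using cont[OF u] t unfolding x_def
      by (intro has_vector_derivative_add has_vector_derivative_const integral_has_vector_derivative) auto
    moreover have "x t' = x0 + integral {0..t'} (\<lambda>s. V (x s))" if "t' \<in> {0..h}" for t'
      using x[of t'] that by (simp add: clamp_def)
    ultimately show ?thesis
      using t by (auto intro: has_vector_derivative_transform)
  qed
  moreover have "x 0 = x0"
    using x[of 0] h by (simp add: clamp_def)
  ultimately show ?thesis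
    using SD[OF u] by (auto simp: ode_solution_def x_def)
qed

lemma ode_solution_append:
  assumes x: "ode_solution V U {0..T} x" and y: "ode_solution V U {0..h} y"
    and T: "0 \<le> T" and h: "0 \<le> h" and eq: "y 0 = x T"
  shows "ode_solution V U {0..T + h} (\<lambda>t. if t \<in> {0..T} then x t else y (t - T))"
  unfolding ode_solution_def
proof (intro ballI conjI)
  fix t assume t: "t \<in> {0..T + h}"
  let ?z = "\<lambda>t. if t \<in> {0..T} then x t else y (t - T)"
  show "?z t \<in> U"
    using x y t by (auto simp: ode_solution_def)
  have y': "((\<lambda>t. y (t - T)) has_vector_derivative V (y (t - T))) (at t within {T..T + h})"
    if "t \<in> {T..T + h}" for t
  proof -
    have 1: "((\<lambda>t. t - T) has_vector_derivative 1) (at t within {T..T + h})"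
      by (auto intro!: derivative_eq_intros)
    have im: "(\<lambda>t. t - T) ` {T..T + h} = {0..h}"
      by (auto simp: image_iff intro!: bexI[of _ "_ + T"])
    have 2: "(y has_vector_derivative V (y (t - T))) (at (t - T) within (\<lambda>t. t - T) ` {T..T + h})"
      using y that unfolding ode_solution_def im by auto
    show ?thesis
      using vector_diff_chain_within[OF 1 2] by (simp add: o_def)
  qed
  have "(?z has_vector_derivative (if t \<in> {0..T} then V (x t) else V (y (t - T))))
      (at t within {0..T + h})"
  proof (rule has_vector_derivative_If_within_closures[where T = "{T..T + h}"])
    show "t \<in> {0..T} \<union> {T..T + h}" "{0..T + h} = {0..T} \<union> {T..T + h}"
      using t T h by auto
    have c: "{0..T} \<union> closure {0..T} \<inter> closure {T..T + h} = {0..T}"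
      "{T..T + h} \<union> closure {0..T} \<inter> closure {T..T + h} = {T..T + h}"
      using T h by auto
    show "(x has_vector_derivative V (x t)) (at t within {0..T} \<union> closure {0..T} \<inter> closure {T..T + h})"
      if "t \<in> {0..T} \<union> closure {0..T} \<inter> closure {T..T + h}"
      using that x unfolding c by (auto simp: ode_solution_def)
    show "((\<lambda>t. y (t - T)) has_vector_derivative V (y (t - T)))
        (at t within {T..T + h} \<union> closure {0..T} \<inter> closure {T..T + h})"
      if "t \<in> {T..T + h} \<union> closure {0..T} \<inter> closure {T..T + h}"
      using that y'[of t] unfolding c by auto
  qed (use eq in auto)
  then show "(?z has_vector_derivative V (?z t)) (at t within {0..T + h})"
    by (auto split: if_splits)
qed

lemma ode_solution_union_increasing:
  fixes T :: "nat \<Rightarrow> real"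
  assumes sol: "\<And>n. ode_solution V U {0..T n} (X n)"
    and ext: "\<And>n t. t \<in> {0..T n} \<Longrightarrow> X (Suc n) t = X n t"
    and inc: "\<And>n. T n < T (Suc n)"
  shows "\<exists>x. (\<forall>n. \<forall>t\<in>{0..T n}. x t = X n t) \<and> ode_solution V U {t. 0 \<le> t \<and> (\<exists>n. t < T n)} x"
proof -
  have mono: "T m \<le> T n" if "m \<le> n" for m n
    using lift_Suc_mono_le[of T, OF less_imp_le[OF inc] that] .
  have agree: "X (m + k) t = X m t" if "t \<in> {0..T m}" for m k t
  proof (induction k)
    case (Suc k)
    then show ?case
      using that mono[of m "m + k"] ext[of t "m + k"] by auto
  qed simp
  define x where "x t = X (LEAST n. t \<le> T n) t" for t
  have x: "x t = X n t" if "t \<in> {0..T n}" for n t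
  proof -
    define m where "m = (LEAST n. t \<le> T n)"
    have "t \<le> T m" "m \<le> n"
      using that unfolding m_def by (auto intro: LeastI Least_le)
    then show ?thesis
      using agree[of t m "n - m"] that by (simp add: x_def m_def[symmetric])
  qed
  moreover have "ode_solution V U {t. 0 \<le> t \<and> (\<exists>n. t < T n)} x" (is "ode_solution V U ?J x")
    unfolding ode_solution_def
  proof (intro ballI conjI)
    fix t assume "t \<in> ?J"
    then obtain n where t: "0 \<le> t" "t < T n"
      by auto
    show "x t \<in> U"
      using sol[of n] x[of t n] t by (auto simp: ode_solution_def)
    have "(X n has_vector_derivative V (x t)) (at t within {0..T n})"
      using sol[of n] x[of t n] t by (auto simp: ode_solution_def)
    then have "(x has_vector_derivative V (x t)) (at t within {0..T n})"
      by (rule has_vector_derivative_transform[rotated 2]) (use t x in auto)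
    moreover have "at t within {0..T n} = at t within ?J"
      by (rule at_within_nhd[of _ "{..<T n}"]) (use t in auto)
    ultimately show "(x has_vector_derivative V (x t)) (at t within ?J)"
      by simp
  qed
  ultimately show ?thesis
    by blast
qed

text \<open>
  Solutions are extended step by step, each step being at least half as long as the longest
  possible step of length at most \<open>1\<close>. If the times reached had a finite supremum, the steps would
  tend to \<open>0\<close>. But the solution obtained would be trapped in one set \<open>K \<epsilon>\<close>, on which
  the local theorem allows steps of a fixed length.
\<close>

theorem ode_global_solution_if_trapped:
  fixes V :: "'a::banach \<Rightarrow> 'a"
  assumes loc_lip: "\<And>\<epsilon>. 0 < \<epsilon> \<Longrightarrow> \<exists>r>0. \<exists>M L. \<forall>x\<in>K \<epsilon>. cball x r \<subseteq> U \<and>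
      (\<forall>y\<in>cball x r. norm (V y) \<le> M) \<and> L-lipschitz_on (cball x r) V"
    and exhaust: "\<And>x. x \<in> U \<Longrightarrow> \<exists>\<epsilon>>0. x \<in> K \<epsilon>"
    and trapped: "\<And>T x. \<lbrakk>0 < T; x 0 = x0; ode_solution V U {0..<T} x\<rbrakk>
      \<Longrightarrow> \<exists>\<epsilon>>0. \<forall>t\<in>{0..<T}. x t \<in> K \<epsilon>"
    and x0: "x0 \<in> U"
  shows "\<exists>x. x 0 = x0 \<and> ode_solution V U {0..} x"
proof -
  define E where "E z = {h. 0 < h \<and> h \<le> 1 \<and> (\<exists>y. y 0 = z \<and> ode_solution V U {0..h} y)}" for z
  have step: "\<exists>h>0. \<forall>z\<in>K \<epsilon>. h \<in> E z" if \<epsilon>: "0 < \<epsilon>" for \<epsilon>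
  proof -
    obtain r M L where r: "0 < r" and bounds: "\<And>x. x \<in> K \<epsilon> \<Longrightarrow> cball x r \<subseteq> U \<and>
      (\<forall>y\<in>cball x r. norm (V y) \<le> M) \<and> L-lipschitz_on (cball x r) V"
      using loc_lip[OF \<epsilon>] by blast
    define h where "h = min 1 (min (r / (\<bar>M\<bar> + 1)) (1 / (\<bar>L\<bar> + 1)))"
    have h: "0 < h" "h \<le> 1"
      using r by (auto simp: h_def)
    have "h * M \<le> h * (\<bar>M\<bar> + 1)"
      using h by (intro mult_left_mono) auto
    also have "\<dots> \<le> r / (\<bar>M\<bar> + 1) * (\<bar>M\<bar> + 1)"
      by (intro mult_right_mono) (auto simp: h_def)
    finally have hM: "h * M \<le> r"
      by (auto split: if_splits)
    have "h * L < h * (\<bar>L\<bar> + 1)"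
      using h by (intro mult_strict_left_mono) auto
    also have "\<dots> \<le> 1 / (\<bar>L\<bar> + 1) * (\<bar>L\<bar> + 1)"
      by (intro mult_right_mono) (auto simp: h_def)
    finally have hL: "h * L < 1"
      by (auto split: if_splits)
    have "h \<in> E z" if "z \<in> K \<epsilon>" for z
    proof -
      have "\<exists>x. x 0 = z \<and> ode_solution V (cball z r) {0..h} x"
        using h r hM hL bounds[OF that] by (intro picard_lindelof_local[of h r M L z V]) auto
      then obtain x where "x 0 = z" "ode_solution V (cball z r) {0..h} x"
        by blast
      moreover have "cball z r \<subseteq> U"
        using bounds[OF that] by blast
      ultimately have "x 0 = z \<and> ode_solution V U {0..h} x"
        unfolding ode_solution_def by blast
      then show ?thesis
        using h by (auto simp: E_def)
    qed
    then show ?thesis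
      using h by blast
  qed
  have near_sup: "\<exists>h\<in>E z. \<forall>h'\<in>E z. h' \<le> 2 * h" if zU: "z \<in> U" for z
  proof -
    obtain h where h: "h \<in> E z"
      using exhaust[OF zU] step by blast
    have bdd: "bdd_above (E z)"
      by (auto simp: E_def bdd_above_def)
    have "h \<le> Sup (E z)" "0 < h"
      using h bdd by (auto intro: cSup_upper simp: E_def)
    then have "Sup (E z) / 2 < Sup (E z)"
      by simp
    then obtain k where "k \<in> E z" "Sup (E z) / 2 < k"
      using less_cSupD[of "E z"] h by blast
    moreover have "h' \<le> Sup (E z)" if "h' \<in> E z" for h'
      using that bdd by (rule cSup_upper)
    ultimately show ?thesis
      by (intro bexI[of _ k]) force+
  qed
  define Q where "Q p q \<longleftrightarrow> (\<forall>t\<in>{0..fst p}. snd q t = snd p t) \<and>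
      fst q - fst p \<in> E (snd p (fst p)) \<and> (\<forall>h\<in>E (snd p (fst p)). h \<le> 2 * (fst q - fst p))"
    for p q :: "real \<times> (real \<Rightarrow> 'a)"
  have "\<exists>f. \<forall>n. (0 \<le> fst (f n) \<and> snd (f n) 0 = x0 \<and> ode_solution V U {0..fst (f n)} (snd (f n)))
      \<and> Q (f n) (f (Suc n))"
  proof (rule dependent_nat_choice)
    have "ode_solution V U {0..0} (\<lambda>_. x0)"
      using x0 by (auto simp: ode_solution_def has_vector_derivative_def has_derivative_def
          bounded_linear_scaleR_left at_within_def)
    then show "\<exists>p::real \<times> (real \<Rightarrow> 'a). 0 \<le> fst p \<and> snd p 0 = x0 \<and> ode_solution V U {0..fst p} (snd p)"
      by (intro exI[of _ "(0, \<lambda>_. x0)"]) auto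
    fix p :: "real \<times> (real \<Rightarrow> 'a)" and n
    assume p: "0 \<le> fst p \<and> snd p 0 = x0 \<and> ode_solution V U {0..fst p} (snd p)"
    define z where "z = snd p (fst p)"
    have "z \<in> U"
      using p by (auto simp: z_def ode_solution_def)
    then obtain h where h: "h \<in> E z" "\<forall>h'\<in>E z. h' \<le> 2 * h"
      using near_sup by blast
    then obtain y where y: "y 0 = z" "ode_solution V U {0..h} y" "0 < h"
      by (auto simp: E_def)
    let ?q = "(fst p + h, \<lambda>t. if t \<in> {0..fst p} then snd p t else y (t - fst p))"
    have "ode_solution V U {0..fst p + h} (snd ?q)"
      unfolding snd_conv using p y by (intro ode_solution_append) (auto simp: z_def)
    then show "\<exists>q. (0 \<le> fst q \<and> snd q 0 = x0 \<and> ode_solution V U {0..fst q} (snd q)) \<and> Q p q"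
      using p h y by (intro exI[of _ ?q]) (auto simp: Q_def z_def)
  qed
  then obtain f where f: "\<And>n. 0 \<le> fst (f n)" "\<And>n. snd (f n) 0 = x0"
      "\<And>n. ode_solution V U {0..fst (f n)} (snd (f n))" and Q: "\<And>n. Q (f n) (f (Suc n))"
    by blast
  define T where "T n = fst (f n)" for n
  define X where "X n = snd (f n)" for n
  have E: "T (Suc n) - T n \<in> E (X n (T n))" "\<And>h. h \<in> E (X n (T n)) \<Longrightarrow> h \<le> 2 * (T (Suc n) - T n)" for n
    using Q[of n] by (auto simp: Q_def T_def X_def)
  have inc: "T n < T (Suc n)" for n
    using E(1)[of n] by (auto simp: E_def)
  obtain x where x: "\<And>n t. t \<in> {0..T n} \<Longrightarrow> x t = X n t"
    and sol: "ode_solution V U {t. 0 \<le> t \<and> (\<exists>n. t < T n)} x"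
  proof -
    have "ode_solution V U {0..T n} (X n)" "t \<in> {0..T n} \<Longrightarrow> X (Suc n) t = X n t" for n t
      using f(3) Q[of n] by (auto simp: Q_def T_def X_def)
    from ode_solution_union_increasing[of V U T X, OF this inc] show ?thesis
      using that by blast
  qed
  have x_0: "x 0 = x0"
    using x[of 0 0] f[of 0] by (auto simp: T_def X_def)
  show ?thesis
  proof (cases "bdd_above (range T)")
    case False
    have "\<exists>n. t < T n" for t
      using False by (auto simp: bdd_above_def not_le)
    then have "{t. 0 \<le> t \<and> (\<exists>n. t < T n)} = {0..}"
      by auto
    then show ?thesis
      using sol x_0 by auto
  next
    case True
    define S where "S = (SUP n. T n)"
    have "incseq T"
      using inc by (intro incseq_SucI less_imp_le)
    then have lim: "T \<longlonglongrightarrow> S"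
      unfolding S_def using True by (intro LIMSEQ_incseq_SUP) auto
    have TS: "T n < S" for n
      using inc[of n] cSUP_upper[OF _ True, of "Suc n"] by (auto simp: S_def)
    have J: "{t. 0 \<le> t \<and> (\<exists>n. t < T n)} = {0..<S}"
      using TS less_cSUP_iff[OF _ True] by (auto simp: S_def intro: less_trans)
    have "0 < S"
      using TS[of 0] f(1)[of 0] by (simp add: T_def)
    then obtain \<epsilon> where "0 < \<epsilon>" and K: "\<And>t. t \<in> {0..<S} \<Longrightarrow> x t \<in> K \<epsilon>"
      using trapped[of S x] x_0 sol J by auto
    then obtain h where "0 < h" and h: "\<And>z. z \<in> K \<epsilon> \<Longrightarrow> h \<in> E z"
      using step by blast
    have le: "h \<le> 2 * (T (Suc n) - T n)" for n
      using E(2)[of h n] h[OF K, of "T n"] x[of "T n" n] f(1)[of n] TS[of n] by (auto simp: T_def)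
    have "(\<lambda>n. 2 * (T (Suc n) - T n)) \<longlonglongrightarrow> 2 * (S - S)"
      using lim by (intro tendsto_intros LIMSEQ_Suc)
    then have "h \<le> 2 * (S - S)"
      by (rule LIMSEQ_le_const) (use le in auto)
    then show ?thesis
      using \<open>0 < h\<close> by simp
  qed
qed

section \<open>Domains whose Green's function is given by a height function\<close>

lemma sum_off_diagonal_swap:
  assumes "finite I"
  shows "(\<Sum>i\<in>I. \<Sum>j\<in>I - {i}. f i j) = (\<Sum>i\<in>I. \<Sum>j\<in>I - {i}. f j i)"
proof -
  have *: "(\<Sum>i\<in>I. \<Sum>j\<in>I - {i}. h i j) = (\<Sum>i\<in>I. \<Sum>j\<in>I. if i = j then 0 else h i j)" for h
    using assms by (intro sum.cong sum.mono_neutral_cong_left) auto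
  show ?thesis
    unfolding * by (subst sum.swap) (auto intro!: sum.cong)
qed

lemma real_derivative_along_curve:
  fixes s :: "complex \<Rightarrow> real"
  assumes "(s has_derivative (\<lambda>h. inner g h)) (at (x t))"
    and "(x has_vector_derivative v) (at t within S)"
  shows "((\<lambda>t. s (x t)) has_real_derivative inner g v) (at t within S)"
  using has_derivative_compose[OF assms(2)[unfolded has_vector_derivative_def] assms(1)]
  by (simp add: has_field_derivative_def mult_commute_abs)

lemma has_real_derivative_norm_squared:
  fixes u :: "real \<Rightarrow> 'a::real_inner"
  assumes u: "(u has_vector_derivative u') (at t within S)"
  shows "((\<lambda>t. (norm (u t))\<^sup>2) has_real_derivative 2 * inner (u t) u') (at t within S)"
proof -
  have "((\<lambda>t. inner (u t) (u t)) has_derivative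
      (\<lambda>h. inner (u t) (h *\<^sub>R u') + inner (h *\<^sub>R u') (u t))) (at t within S)"
    using u unfolding has_vector_derivative_def by (intro has_derivative_inner)
  moreover have "(\<lambda>h. inner (u t) (h *\<^sub>R u') + inner (h *\<^sub>R u') (u t)) = (*) (2 * inner (u t) u')"
    by (auto simp: inner_commute)
  ultimately show ?thesis
    by (simp add: has_field_derivative_def power2_norm_eq_inner)
qed

text \<open>
  Here \<open>g\<close> is the gradient of the height function \<open>s\<close>, and \<open>B x y\<close> is the quantity in the denominator of
  the Green's function: \<open>x - cnj y\<close> for the half-plane, \<open>x * cnj y - 1\<close> for the disk. Assumption
  \<open>g_affine\<close> says that \<open>s\<close> is a quadratic polynomial whose Hessian is a multiple of the
  identity; it makes the flux between two vortices antisymmetric. Assumption \<open>factor\<close> says that the gradient of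
  \<open>ln (norm (B x y))\<close> in \<open>x\<close> is \<open>e y / cnj (B x y)\<close>. As \<open>e\<close> is bounded and \<open>B\<close> Lipschitz, the vector field is seen to be bounded and Lipschitz away
  from collisions and from the boundary, although the half-plane is unbounded.
\<close>

locale vortex_domain =
  fixes \<Omega> :: "complex set" and s :: "complex \<Rightarrow> real" and g e :: "complex \<Rightarrow> complex"
    and B :: "complex \<Rightarrow> complex \<Rightarrow> complex" and \<kappa> :: real
  assumes mem_iff: "x \<in> \<Omega> \<longleftrightarrow> 0 < s x"
    and norm_B: "(norm (B x y))\<^sup>2 = (norm (x - y))\<^sup>2 + s x * s y"
    and s_deriv: "(s has_derivative (\<lambda>h. inner (g x) h)) (at x)"
    and s_diff: "\<bar>s x - s y\<bar> \<le> (norm (g x) + norm (g y)) / 2 * norm (x - y)"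
    and \<kappa>: "0 \<le> \<kappa>" "\<kappa> \<le> 1"
    and g_affine: "g x - g y = - (2 * \<kappa>) *\<^sub>R (x - y)"
    and norm_g: "x \<in> \<Omega> \<Longrightarrow> norm (g x) \<le> 2"
    and factor: "2 * (x - y) + s y *\<^sub>R g x = 2 * e y * B x y"
    and norm_e: "x \<in> \<Omega> \<Longrightarrow> norm (e x) \<le> 1"
    and e_diff: "norm (e x - e y) \<le> norm (x - y)"
    and B_diff: "\<lbrakk>x \<in> \<Omega>; y \<in> \<Omega>; x' \<in> \<Omega>; y' \<in> \<Omega>\<rbrakk>
      \<Longrightarrow> norm (B x y - B x' y') \<le> norm (x - x') + norm (y - y')"
begin

lemma s_pos: "x \<in> \<Omega> \<Longrightarrow> 0 < s x"
  by (simp add: mem_iff)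

lemma s_diff_le: "\<lbrakk>x \<in> \<Omega>; y \<in> \<Omega>\<rbrakk> \<Longrightarrow> \<bar>s x - s y\<bar> \<le> 2 * norm (x - y)"
  using s_diff[of x y] norm_g[of x] norm_g[of y]
    mult_right_mono[of "(norm (g x) + norm (g y)) / 2" 2 "norm (x - y)"] by simp

lemma s_near:
  assumes "x \<in> \<Omega>"
  shows "\<bar>s x - s y\<bar> \<le> (2 + norm (x - y)) * norm (x - y)"
proof -
  have "norm (g y - g x) \<le> 2 * norm (x - y)"
    using \<kappa> mult_right_mono[of \<kappa> 1 "norm (x - y)"] by (simp add: g_affine norm_minus_commute)
  moreover have "norm (g y) \<le> norm (g x) + norm (g y - g x)"
    using norm_triangle_ineq[of "g x" "g y - g x"] by simp
  ultimately have "(norm (g x) + norm (g y)) / 2 \<le> 2 + norm (x - y)"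
    using norm_g[OF assms] by simp
  then show ?thesis
    using s_diff[of x y] mult_right_mono[OF _ norm_ge_zero[of "x - y"]] order_trans by blast
qed

lemma norm_B_commute: "norm (B x y) = norm (B y x)"
proof -
  have "(norm (B x y))\<^sup>2 = (norm (B y x))\<^sup>2"
    by (simp add: norm_B norm_minus_commute mult.commute)
  then show ?thesis
    by simp
qed

lemma norm_diff_le_norm_B:
  assumes "x \<in> \<Omega>" "y \<in> \<Omega>"
  shows "norm (x - y) \<le> norm (B x y)"
  by (rule power2_le_imp_le) (use assms s_pos in \<open>auto simp: norm_B intro: less_imp_le\<close>)

lemma s_mult_le_norm_B: "s x * s y \<le> (norm (B x y))\<^sup>2"
  by (simp add: norm_B)

lemma norm_B_pos:
  assumes "x \<in> \<Omega>" "y \<in> \<Omega>"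
  shows "0 < norm (B x y)"
proof -
  have "0 < (norm (B x y))\<^sup>2"
    using s_mult_le_norm_B[of x y] s_pos[OF assms(1)] s_pos[OF assms(2)]
    by (meson less_le_trans mult_pos_pos)
  then show ?thesis
    by auto
qed

lemma norm_B_self: "x \<in> \<Omega> \<Longrightarrow> norm (B x x) = s x"
  using norm_B[of x x] s_pos[of x] power2_eq_iff_nonneg[of "norm (B x x)" "s x"]
  by (simp add: power2_eq_square)

definition green :: "complex \<Rightarrow> complex \<Rightarrow> real" where
  "green x y = 1 / (2 * pi) * ln (norm (x - y) / norm (B x y))"

definition robin_fun :: "complex \<Rightarrow> real" where
  "robin_fun x = - 1 / (2 * pi) * ln (s x)"

text \<open>
  The gradients of \<open>green\<close> in its first variable and of \<open>robin_fun\<close>, as complex numbers.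
\<close>

definition pair_grad :: "complex \<Rightarrow> complex \<Rightarrow> complex" where
  "pair_grad x y = (1 / (2 * pi)) *\<^sub>R (1 / cnj (x - y) - e y / cnj (B x y))"

definition self_grad :: "complex \<Rightarrow> complex" where
  "self_grad x = - (1 / pi) *\<^sub>R (e x / cnj (B x x))"

text \<open>
  The rate at which a vortex of unit intensity at \<open>y\<close> raises the height of a vortex at \<open>x\<close>.
\<close>

definition flux :: "complex \<Rightarrow> complex \<Rightarrow> real" where
  "flux x y = inner (g x) (\<i> * (x - y)) * (s x * s y)
     / (2 * pi * (norm (x - y))\<^sup>2 * (norm (B x y))\<^sup>2)"

lemma divide_cnj: "w / cnj z = (1 / (norm z)\<^sup>2) *\<^sub>R (w * z)" if "z \<noteq> 0" for w z :: complex
proof -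
  have "z * cnj z = complex_of_real ((norm z)\<^sup>2)"
    using complex_norm_square[of z] by simp
  moreover have "complex_of_real ((norm z)\<^sup>2) \<noteq> 0"
    using that by simp
  ultimately show ?thesis
    using that by (simp add: scaleR_conv_of_real field_simps del: of_real_power)
qed

text \<open>
  The gradient in terms of the height function, for the exact computations; the definition
  itself serves for the Lipschitz estimates.
\<close>

lemma pair_grad_eq:
  assumes "x \<in> \<Omega>" "y \<in> \<Omega>" "x \<noteq> y"
  shows "pair_grad x y = (1 / (4 * pi)) *\<^sub>R ((2 / (norm (x - y))\<^sup>2) *\<^sub>R (x - y)
     - (1 / (norm (B x y))\<^sup>2) *\<^sub>R (2 * (x - y) + s y *\<^sub>R g x))"
proof -
  have "B x y \<noteq> 0"
    using norm_B_pos[OF assms(1,2)] by auto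
  then have "pair_grad x y = (1 / (2 * pi)) *\<^sub>R ((1 / (norm (x - y))\<^sup>2) *\<^sub>R (x - y)
     - (1 / (norm (B x y))\<^sup>2) *\<^sub>R (e y * B x y))"
    unfolding pair_grad_def using assms(3) by (simp only: divide_cnj eq_iff_diff_eq_0[symmetric] not_False_eq_True mult_1)
  also have "\<dots> = (1 / (4 * pi)) *\<^sub>R ((2 / (norm (x - y))\<^sup>2) *\<^sub>R (x - y)
     - (1 / (norm (B x y))\<^sup>2) *\<^sub>R (2 * e y * B x y))"
  proof -
    have "2 * e y * B x y = 2 *\<^sub>R (e y * B x y)"
      by (simp add: scaleR_conv_of_real)
    then show ?thesis
      by (simp add: scaleR_right_diff_distrib)
  qed
  finally show ?thesis
    by (simp only: factor)
qed

lemma self_grad_eq: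
  assumes "x \<in> \<Omega>"
  shows "self_grad x = - (1 / (2 * pi * s x)) *\<^sub>R g x"
proof -
  have "B x x \<noteq> 0"
    using norm_B_pos[OF assms assms] by auto
  then have "self_grad x = - (1 / pi) *\<^sub>R ((1 / (s x)\<^sup>2) *\<^sub>R (e x * B x x))"
    unfolding self_grad_def by (simp only: divide_cnj norm_B_self[OF assms] not_False_eq_True)
  also have "e x * B x x = (s x / 2) *\<^sub>R g x"
    using factor[of x x] by (simp add: scaleR_conv_of_real field_simps)
  finally show ?thesis
    using s_pos[OF assms] by (simp add: power2_eq_square field_simps)
qed

lemma inner_rotate_self: "inner w (\<i> * w) = 0" for w :: complex
  by (simp add: inner_complex_def)

lemma inner_rotate_scaleR: "inner w (\<i> * (c *\<^sub>R v)) = c * inner w (\<i> * v)" for w v :: complex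
  by (simp add: inner_complex_def algebra_simps)

lemma inner_pair_grad:
  assumes "x \<in> \<Omega>" "y \<in> \<Omega>" "x \<noteq> y"
  shows "inner (g x) (\<i> * pair_grad x y) = flux x y"
proof -
  define m where "m = inner (g x) (\<i> * (x - y))"
  define d where "d = (norm (x - y))\<^sup>2"
  define D where "D = (norm (B x y))\<^sup>2"
  have pos: "0 < d" "0 < D"
    using assms(3) norm_B_pos[OF assms(1,2)] by (auto simp: d_def D_def)
  have D: "D = d + s x * s y"
    by (simp add: D_def d_def norm_B)
  have "inner (g x) (\<i> * pair_grad x y) = 1 / (4 * pi) * (2 / d * m - 1 / D * (2 * m))"
    unfolding pair_grad_eq[OF assms] inner_rotate_scaleR d_def[symmetric] D_def[symmetric]
    by (simp add: m_def inner_complex_def algebra_simps)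
  also have "\<dots> = m * (D - d) / (2 * pi * d * D)"
    using pos by (simp add: field_simps)
  also have "D - d = s x * s y"
    by (simp add: D)
  finally show ?thesis
    by (simp add: flux_def m_def d_def D_def)
qed

text \<open>
  The self-interaction moves a vortex along the level lines of \<open>s\<close>.
\<close>

lemma inner_self_grad:
  assumes "x \<in> \<Omega>"
  shows "inner (g x) (\<i> * self_grad x) = 0"
  unfolding self_grad_eq[OF assms] inner_rotate_scaleR inner_rotate_self by simp

text \<open>
  By \<open>g_affine\<close> the vectors \<open>g x\<close> and \<open>g y\<close> differ by a multiple of \<open>x - y\<close>, which is orthogonal to
  \<open>\<i> * (x - y)\<close>.
\<close>

lemma flux_antisym: "flux y x = - flux x y"
proof -
  have "inner (g x - g y) (\<i> * (x - y)) = 0"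
    unfolding g_affine inner_scaleR_left inner_rotate_self by simp
  then have "inner (g y) (\<i> * (y - x)) = - inner (g x) (\<i> * (x - y))"
    by (simp add: inner_complex_def algebra_simps)
  then show ?thesis
    by (simp add: flux_def norm_minus_commute norm_B_commute mult_ac)
qed

lemma abs_flux_le:
  assumes "x \<in> \<Omega>" "y \<in> \<Omega>"
  shows "\<bar>flux x y\<bar> \<le> s x * s y / (norm (x - y) * (norm (B x y))\<^sup>2)"
proof (cases "x = y")
  case False
  have "\<bar>inner (g x) (\<i> * (x - y))\<bar> \<le> norm (g x) * norm (x - y)"
    using Cauchy_Schwarz_ineq2[of "g x" "\<i> * (x - y)"] by (simp add: norm_mult)
  also have "\<dots> \<le> 2 * norm (x - y)"
    using norm_g[OF assms(1)] by (intro mult_right_mono) auto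
  also have "\<dots> \<le> 2 * pi * norm (x - y)"
    using pi_ge_two by (intro mult_right_mono) auto
  finally have m: "\<bar>inner (g x) (\<i> * (x - y))\<bar> \<le> 2 * pi * norm (x - y)" .
  have "\<bar>flux x y\<bar> = \<bar>inner (g x) (\<i> * (x - y))\<bar> * (s x * s y)
      / (2 * pi * (norm (x - y))\<^sup>2 * (norm (B x y))\<^sup>2)"
    using s_pos[OF assms(1)] s_pos[OF assms(2)] by (simp add: flux_def abs_mult)
  also have "\<dots> \<le> 2 * pi * norm (x - y) * (s x * s y)
      / (2 * pi * (norm (x - y))\<^sup>2 * (norm (B x y))\<^sup>2)"
    using s_pos[OF assms(1)] s_pos[OF assms(2)] m by (intro divide_right_mono mult_right_mono) auto
  also have "\<dots> = s x * s y / (norm (x - y) * (norm (B x y))\<^sup>2)"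
    using False by (simp add: power2_eq_square)
  finally show ?thesis .
qed (simp add: flux_def)

text \<open>
  The flux has a singularity of order \<open>1 / norm (x - y)\<close>, and the difference of heights is
  \<open>O(norm (x - y))\<close>. The bound is uniform up to the boundary since \<open>s x * s y \<le> (norm (B x y))\<^sup>2\<close>.
\<close>

lemma abs_flux_mult_diff_le:
  assumes "x \<in> \<Omega>" "y \<in> \<Omega>"
  shows "\<bar>flux x y\<bar> * \<bar>s x - s y\<bar> \<le> 2"
proof (cases "x = y")
  case False
  have "\<bar>flux x y\<bar> * \<bar>s x - s y\<bar> \<le> s x * s y / (norm (x - y) * (norm (B x y))\<^sup>2) * (2 * norm (x - y))"
    using abs_flux_le[OF assms] s_diff_le[OF assms] s_pos[OF assms(1)] s_pos[OF assms(2)]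
    by (intro mult_mono) auto
  also have "\<dots> = 2 * (s x * s y / (norm (B x y))\<^sup>2)"
    using False by (simp add: field_simps)
  also have "\<dots> \<le> 2 * 1"
    using s_mult_le_norm_B[of x y] norm_B_pos[OF assms] by (intro mult_left_mono) auto
  finally show ?thesis
    by simp
qed simp

lemma abs_flux_le_separated:
  assumes "x \<in> \<Omega>" "y \<in> \<Omega>" "0 < \<eta>" "\<eta> \<le> norm (x - y)"
  shows "\<bar>flux x y\<bar> \<le> s x * s y / \<eta> ^ 3"
proof -
  have "\<eta> ^ 3 \<le> norm (x - y) ^ 3"
    using assms(3,4) by (intro power_mono) auto
  also have "\<dots> \<le> norm (x - y) * (norm (B x y))\<^sup>2"
    using norm_diff_le_norm_B[OF assms(1,2)]
    by (auto simp: power2_eq_square power3_eq_cube mult.assoc intro!: mult_left_mono mult_mono)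
  finally have "s x * s y / (norm (x - y) * (norm (B x y))\<^sup>2) \<le> s x * s y / \<eta> ^ 3"
    using s_pos[OF assms(1)] s_pos[OF assms(2)] assms(3,4) norm_B_pos[OF assms(1,2)]
    by (intro divide_left_mono mult_pos_pos) auto
  then show ?thesis
    using abs_flux_le[OF assms(1,2)] by simp
qed

lemma green_eq:
  assumes "x \<in> \<Omega>" "y \<in> \<Omega>" "x \<noteq> y"
  shows "green x y = 1 / (4 * pi) * (ln ((norm (x - y))\<^sup>2) - ln ((norm (x - y))\<^sup>2 + s x * s y))"
  unfolding norm_B[symmetric]
  using assms norm_B_pos[OF assms(1,2)] by (simp add: green_def ln_div ln_realpow field_simps)

lemma open_domain: "open \<Omega>"
proof -
  have "continuous_on UNIV s"
    using s_deriv has_derivative_continuous by (blast intro: continuous_at_imp_continuous_on)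
  then have "open {x. 0 < s x}"
    by (intro open_Collect_less) auto
  then show ?thesis
    by (simp add: mem_iff[symmetric])
qed

text \<open>
  Applied to lines parallel to the axes this gives the perpendicular gradient, applied to trajectories it
  gives the time derivative of the Hamiltonian.
\<close>

lemma green_curve_derivative:
  assumes x: "(x has_vector_derivative x') (at t within S)"
    and y: "(y has_vector_derivative y') (at t within S)"
    and t: "t \<in> S" and dom: "x t \<in> \<Omega>" "y t \<in> \<Omega>" "x t \<noteq> y t"
  shows "((\<lambda>t. green (x t) (y t)) has_real_derivative
      inner (pair_grad (x t) (y t)) x' + inner (pair_grad (y t) (x t)) y') (at t within S)"
proof -
  define G where "G t = 1 / (4 * pi) * (ln ((norm (x t - y t))\<^sup>2)
      - ln ((norm (x t - y t))\<^sup>2 + s (x t) * s (y t)))" for t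
  define d where "d = (norm (x t - y t))\<^sup>2"
  define D where "D = (norm (B (x t) (y t)))\<^sup>2"
  define m where "m = inner (x t - y t) (x' - y')"
  have pos: "0 < d" "0 < D"
    using dom norm_B_pos[of "x t" "y t"] by (auto simp: d_def D_def)
  have D: "D = d + s (x t) * s (y t)"
    by (simp add: D_def d_def norm_B)
  have xy: "((\<lambda>t. x t - y t) has_vector_derivative x' - y') (at t within S)"
    by (intro has_vector_derivative_diff x y)
  have nd: "((\<lambda>t. (norm (x t - y t))\<^sup>2) has_real_derivative 2 * m) (at t within S)"
    using has_real_derivative_norm_squared[OF xy] by (simp add: m_def)
  have sx: "((\<lambda>t. s (x t)) has_real_derivative inner (g (x t)) x') (at t within S)"
    and sy: "((\<lambda>t. s (y t)) has_real_derivative inner (g (y t)) y') (at t within S)"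
    by (rule real_derivative_along_curve s_deriv x y)+
  have "(G has_real_derivative 1 / (4 * pi) * (1 / d * (2 * m) -
      1 / D * (2 * m + (inner (g (x t)) x' * s (y t) + inner (g (y t)) y' * s (x t))))) (at t within S)"
    unfolding G_def D d_def
    by (intro DERIV_cmult DERIV_diff DERIV_chain2[OF DERIV_ln_divide] DERIV_add DERIV_mult nd sx sy)
      (use pos D in \<open>auto simp: d_def\<close>)
  moreover have "1 / (4 * pi) * (1 / d * (2 * m) -
      1 / D * (2 * m + (inner (g (x t)) x' * s (y t) + inner (g (y t)) y' * s (x t))))
      = inner (pair_grad (x t) (y t)) x' + inner (pair_grad (y t) (x t)) y'"
  proof -
    have d': "(norm (y t - x t))\<^sup>2 = d" "(norm (B (y t) (x t)))\<^sup>2 = D"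
      by (auto simp: d_def D_def norm_minus_commute norm_B_commute)
    have 2: "(2::complex) * w = 2 *\<^sub>R w" for w
      by (simp add: scaleR_conv_of_real)
    have "x t - y t = - (y t - x t)"
      by simp
    show ?thesis
      unfolding pair_grad_eq[OF dom] pair_grad_eq[OF dom(2,1) dom(3)[symmetric]] d'
        d_def[symmetric] D_def[symmetric] m_def 2 inner_scaleR_left inner_diff_left inner_diff_right inner_add_left
      using pos by (simp add: field_simps)
  qed
  ultimately have G': "(G has_real_derivative
      inner (pair_grad (x t) (y t)) x' + inner (pair_grad (y t) (x t)) y') (at t within S)"
    by simp
  have cont: "(x \<longlongrightarrow> x t) (at t within S)" "(y \<longlongrightarrow> y t) (at t within S)"
    using x y has_vector_derivative_continuous by (auto simp: continuous_within)
  have "\<forall>\<^sub>F t in at t within S. x t \<in> \<Omega>" "\<forall>\<^sub>F t in at t within S. y t \<in> \<Omega>"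
    using cont dom open_domain by (auto intro: topological_tendstoD)
  moreover have "\<forall>\<^sub>F t in at t within S. x t - y t \<noteq> 0"
    using tendsto_diff[OF cont] dom by (intro tendsto_imp_eventually_ne) auto
  ultimately have "\<forall>\<^sub>F t in at t within S. G t = green (x t) (y t)"
    by eventually_elim (simp add: G_def green_eq)
  then show ?thesis
    using G' dom t green_eq[OF dom]
    by (auto simp: G_def has_field_derivative_def intro: has_derivative_transform_eventually)
qed

lemma robin_curve_derivative:
  assumes x: "(x has_vector_derivative x') (at t within S)" and dom: "x t \<in> \<Omega>"
  shows "((\<lambda>t. robin_fun (x t)) has_real_derivative inner (self_grad (x t)) x') (at t within S)"
proof -
  have sx: "((\<lambda>t. s (x t)) has_real_derivative inner (g (x t)) x') (at t within S)"
    by (rule real_derivative_along_curve s_deriv x)+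
  show ?thesis
    unfolding robin_fun_def
    using DERIV_cmult[OF DERIV_chain2[OF DERIV_ln_divide[OF s_pos[OF dom]] sx], of "- 1 / (2 * pi)"]
    by (simp add: self_grad_eq[OF dom])
qed

end

section \<open>A priori bounds for vortex trajectories\<close>

lemma convergent_subsequence_finite_family:
  fixes u :: "'i \<Rightarrow> nat \<Rightarrow> real"
  assumes "finite I" and "\<And>i n. i \<in> I \<Longrightarrow> u i n \<in> {0..S}"
  shows "\<exists>r c. strict_mono (r :: nat \<Rightarrow> nat) \<and> (\<forall>i\<in>I. (\<lambda>n. u i (r n)) \<longlonglongrightarrow> c i)"
  using assms
proof (induction I rule: finite_induct)
  case empty
  then show ?case
    by (intro exI[of _ id]) (auto simp: strict_mono_def)
next
  case (insert k I)
  then obtain r c where r: "strict_mono r" and c: "\<forall>i\<in>I. (\<lambda>n. u i (r n)) \<longlonglongrightarrow> c i"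
    by auto
  have "seq_compact {0..S}"
    by (simp add: compact_imp_seq_compact)
  then obtain l q where q: "strict_mono q" and l: "((\<lambda>n. u k (r n)) \<circ> q) \<longlonglongrightarrow> l"
    using insert.prems by (metis insertI1 seq_compactE)
  have "(\<lambda>n. u i (r (q n))) \<longlonglongrightarrow> (c(k := l)) i" if "i \<in> insert k I" for i
    using that l LIMSEQ_subseq_LIMSEQ[OF bspec[OF c] q, of i] insert.hyps by (auto simp: o_def)
  then show ?case
    using strict_mono_o[OF r q] by (intro exI[of _ "r \<circ> q"] exI[of _ "c(k := l)"]) (simp add: o_def)
qed

context vortex_domain
begin

text \<open>
  The right-hand side of the point-vortex system, the rotation by a right angle being the multiplication by \<open>\<i>\<close>.
\<close>

definition velocity :: "'i set \<Rightarrow> ('i \<Rightarrow> real) \<Rightarrow> ('i \<Rightarrow> complex) \<Rightarrow> 'i \<Rightarrow> complex" where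
  "velocity I a w i = \<i> * ((\<Sum>j\<in>I - {i}. a j *\<^sub>R pair_grad (w i) (w j)) + (a i / 2) *\<^sub>R self_grad (w i))"

end

locale vortex_motion = vortex_domain +
  fixes I :: "'i set" and a :: "'i \<Rightarrow> real" and z :: "'i \<Rightarrow> real \<Rightarrow> complex" and T :: real
  assumes finite: "finite I"
    and a_pos: "i \<in> I \<Longrightarrow> 0 < a i"
    and T_pos: "0 < T"
    and in_domain: "\<lbrakk>i \<in> I; t \<in> {0..<T}\<rbrakk> \<Longrightarrow> z i t \<in> \<Omega>"
    and distinct: "\<lbrakk>i \<in> I; j \<in> I; i \<noteq> j; t \<in> {0..<T}\<rbrakk> \<Longrightarrow> z i t \<noteq> z j t"
    and motion: "\<lbrakk>i \<in> I; t \<in> {0..<T}\<rbrakk> \<Longrightarrow>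
      (z i has_vector_derivative velocity I a (\<lambda>j. z j t) i) (at t within {0..<T})"
begin

abbreviation height :: "'i \<Rightarrow> real \<Rightarrow> real" where
  "height i t \<equiv> s (z i t)"

lemma height_pos: "\<lbrakk>i \<in> I; t \<in> {0..<T}\<rbrakk> \<Longrightarrow> 0 < height i t"
  using in_domain s_pos by blast

lemma height_derivative:
  assumes "i \<in> I" "t \<in> {0..<T}"
  shows "(height i has_real_derivative (\<Sum>j\<in>I - {i}. a j * flux (z i t) (z j t))) (at t within {0..<T})"
proof -
  have "inner (g (z i t)) (velocity I a (\<lambda>j. z j t) i) =
      (\<Sum>j\<in>I - {i}. a j * inner (g (z i t)) (\<i> * pair_grad (z i t) (z j t)))
      + a i / 2 * inner (g (z i t)) (\<i> * self_grad (z i t))"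
    by (simp add: velocity_def distrib_left inner_add_right sum_distrib_left inner_sum_right
        inner_rotate_scaleR)
  also have "\<dots> = (\<Sum>j\<in>I - {i}. a j * flux (z i t) (z j t))"
    using assms in_domain distinct[OF assms(1)]
    by (auto simp: inner_self_grad intro!: sum.cong inner_pair_grad)
  finally show ?thesis
    using real_derivative_along_curve[OF s_deriv motion[OF assms]] by simp
qed

lemma continuous_height:
  assumes "i \<in> I"
  shows "continuous_on {0..<T} (height i)"
  using height_derivative[OF assms] DERIV_continuous
  by (blast intro: continuous_on_eq_continuous_within[THEN iffD2])

text \<open>
  Symmetrisation of a double sum by antisymmetry of the flux. For constant \<open>c\<close> the sum vanishes: the flux
  inside any group of vortices does not change the impulse of the group.
\<close>

lemma weighted_flux_sum:
  assumes "A \<subseteq> I"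
  shows "(\<Sum>i\<in>A. c i * a i * (\<Sum>j\<in>A - {i}. a j * flux (w i) (w j)))
    = (\<Sum>i\<in>A. \<Sum>j\<in>A - {i}. (c i - c j) * (a i * a j) * flux (w i) (w j)) / 2"
proof -
  define h where "h i j = c i * (a i * a j) * flux (w i) (w j)" for i j
  have "(\<Sum>i\<in>A. c i * a i * (\<Sum>j\<in>A - {i}. a j * flux (w i) (w j))) = (\<Sum>i\<in>A. \<Sum>j\<in>A - {i}. h i j)"
    by (simp add: h_def sum_distrib_left mult_ac)
  moreover have "(\<Sum>i\<in>A. \<Sum>j\<in>A - {i}. (c i - c j) * (a i * a j) * flux (w i) (w j))
      = (\<Sum>i\<in>A. \<Sum>j\<in>A - {i}. h i j + h j i)"
  proof (intro sum.cong refl)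
    fix i j
    show "(c i - c j) * (a i * a j) * flux (w i) (w j) = h i j + h j i"
      by (simp add: h_def flux_antisym[of "w j" "w i"] algebra_simps)
  qed
  moreover have "(\<Sum>i\<in>A. \<Sum>j\<in>A - {i}. h j i) = (\<Sum>i\<in>A. \<Sum>j\<in>A - {i}. h i j)"
    using finite_subset[OF assms finite] by (rule sum_off_diagonal_swap[symmetric])
  ultimately show ?thesis
    by (simp add: sum.distrib)
qed

definition total_impulse :: real where
  "total_impulse = (\<Sum>i\<in>I. a i * height i 0)"

lemma impulse_conserved:
  assumes t: "t \<in> {0..<T}"
  shows "(\<Sum>i\<in>I. a i * height i t) = total_impulse"
proof -
  have "((\<lambda>t. \<Sum>i\<in>I. a i * height i t) has_real_derivative 0) (at t within {0..<T})"
    if "t \<in> {0..<T}" for t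
  proof -
    have "((\<lambda>t. \<Sum>i\<in>I. a i * height i t) has_real_derivative
        (\<Sum>i\<in>I. a i * (\<Sum>j\<in>I - {i}. a j * flux (z i t) (z j t)))) (at t within {0..<T})"
      using height_derivative that by (intro DERIV_sum DERIV_cmult) auto
    then show ?thesis
      using weighted_flux_sum[of I "\<lambda>_. 1" "\<lambda>i. z i t"] by simp
  qed
  then have "\<exists>c. \<forall>t\<in>{0..<T}. (\<Sum>i\<in>I. a i * height i t) = c"
    by (intro has_field_derivative_zero_constant) auto
  then show ?thesis
    using t T_pos by (auto simp: total_impulse_def)
qed

definition height_bound :: real where
  "height_bound = (\<Sum>i\<in>I. total_impulse / a i)"

lemma height_le:
  assumes "i \<in> I" "t \<in> {0..<T}"
  shows "height i t \<le> height_bound"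
proof -
  have nn: "0 \<le> a j * height j t" if "j \<in> I" for j
    using a_pos[OF that] height_pos[OF that assms(2)] by simp
  have "a i * height i t \<le> (\<Sum>j\<in>I. a j * height j t)"
    using assms(1) finite nn by (intro member_le_sum) auto
  then have le: "a i * height i t \<le> total_impulse"
    by (simp add: impulse_conserved[OF assms(2)])
  then have "height i t \<le> total_impulse / a i"
    using a_pos[OF assms(1)] by (simp add: field_simps)
  also have "0 \<le> total_impulse"
    using le nn[OF assms(1)] by simp
  then have "total_impulse / a i \<le> (\<Sum>i\<in>I. total_impulse / a i)"
    using assms(1) finite a_pos by (intro member_le_sum) (auto intro: divide_nonneg_pos)
  finally show ?thesis
    by (simp add: height_bound_def)
qed

text \<open>
  After symmetrisation the derivative contains \<open>p' (s x) - p' (s y)\<close> times the flux, where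
  \<open>p'\<close> is Lipschitz on the bounded range of the heights, so \<open>abs_flux_mult_diff_le\<close> applies. The constant
  depends neither on the distances nor on how near the boundary is.
\<close>

lemma polynomial_height_moment_lipschitz:
  "\<exists>C. \<forall>t\<in>{0..<T}. \<forall>u\<in>{0..<T}.
    \<bar>(\<Sum>i\<in>I. a i * poly p (height i t)) - (\<Sum>i\<in>I. a i * poly p (height i u))\<bar> \<le> C * \<bar>t - u\<bar>"
proof -
  let ?p' = "pderiv p" and ?p'' = "pderiv (pderiv p)"
  let ?H = "{0..height_bound}"
  have "bounded (poly ?p'' ` ?H)"
    by (intro compact_imp_bounded compact_continuous_image continuous_intros) auto
  then obtain M where M: "\<And>\<sigma>. \<sigma> \<in> ?H \<Longrightarrow> \<bar>poly ?p'' \<sigma>\<bar> \<le> M"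
    unfolding bounded_iff by (auto simp del: atLeastAtMost_iff)
  have lip: "\<bar>poly ?p' \<sigma> - poly ?p' \<tau>\<bar> \<le> M * \<bar>\<sigma> - \<tau>\<bar>" if "\<sigma> \<in> ?H" "\<tau> \<in> ?H" for \<sigma> \<tau>
    using field_differentiable_bound[of ?H "poly ?p'" "poly ?p''" M \<sigma> \<tau>] M that
    by (auto intro: has_field_derivative_at_within[OF poly_DERIV])
  define C where "C = (\<Sum>i\<in>I. \<Sum>j\<in>I - {i}. a i * a j * (M * 2)) / 2"
  define D where "D t = (\<Sum>i\<in>I. poly ?p' (height i t) * a i * (\<Sum>j\<in>I - {i}. a j * flux (z i t) (z j t)))" for t
  have deriv: "((\<lambda>t. \<Sum>i\<in>I. a i * poly p (height i t)) has_real_derivative D t) (at t within {0..<T})"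
    if "t \<in> {0..<T}" for t
  proof -
    have "((\<lambda>t. \<Sum>i\<in>I. a i * poly p (height i t)) has_real_derivative
        (\<Sum>i\<in>I. a i * (poly ?p' (height i t) * (\<Sum>j\<in>I - {i}. a j * flux (z i t) (z j t))))) (at t within {0..<T})"
      using height_derivative that by (intro DERIV_sum DERIV_cmult DERIV_chain2[OF poly_DERIV]) auto
    then show ?thesis
      by (simp add: D_def mult_ac)
  qed
  have bound: "\<bar>D t\<bar> \<le> C" if t: "t \<in> {0..<T}" for t
  proof -
    let ?h = "\<lambda>i j. (poly ?p' (height i t) - poly ?p' (height j t)) * (a i * a j) * flux (z i t) (z j t)"
    have "\<bar>?h i j\<bar> \<le> a i * a j * (M * 2)" if ij: "i \<in> I" "j \<in> I" for i j
    proof -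
      have H: "height i t \<in> ?H" "height j t \<in> ?H"
        using height_le height_pos ij t by (auto intro: less_imp_le)
      have M0: "0 \<le> M"
        using M[OF H(1)] by simp
      have "\<bar>?h i j\<bar> = a i * a j * (\<bar>poly ?p' (height i t) - poly ?p' (height j t)\<bar> * \<bar>flux (z i t) (z j t)\<bar>)"
        using a_pos[OF ij(1)] a_pos[OF ij(2)] by (simp add: abs_mult)
      also have "\<dots> \<le> a i * a j * (M * \<bar>height i t - height j t\<bar> * \<bar>flux (z i t) (z j t)\<bar>)"
        using a_pos[OF ij(1)] a_pos[OF ij(2)] lip[OF H] by (intro mult_left_mono mult_right_mono) auto
      also have "\<dots> \<le> a i * a j * (M * 2)"
        unfolding mult.assoc[of M]
        using a_pos[OF ij(1)] a_pos[OF ij(2)] M0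
          abs_flux_mult_diff_le[OF in_domain[OF ij(1) t] in_domain[OF ij(2) t]]
        by (intro mult_left_mono) (auto simp: mult.commute)
      finally show ?thesis .
    qed
    then have "(\<Sum>i\<in>I. \<Sum>j\<in>I - {i}. \<bar>?h i j\<bar>) \<le> (\<Sum>i\<in>I. \<Sum>j\<in>I - {i}. a i * a j * (M * 2))"
      by (intro sum_mono) auto
    moreover have "\<bar>\<Sum>i\<in>I. \<Sum>j\<in>I - {i}. ?h i j\<bar> \<le> (\<Sum>i\<in>I. \<Sum>j\<in>I - {i}. \<bar>?h i j\<bar>)"
      by (intro order_trans[OF sum_abs] sum_mono sum_abs)
    moreover have "D t = (\<Sum>i\<in>I. \<Sum>j\<in>I - {i}. ?h i j) / 2"
      unfolding D_def by (rule weighted_flux_sum) simp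
    ultimately show ?thesis
      by (simp add: C_def)
  qed
  have "\<bar>(\<Sum>i\<in>I. a i * poly p (height i t)) - (\<Sum>i\<in>I. a i * poly p (height i u))\<bar> \<le> C * \<bar>t - u\<bar>"
    if "t \<in> {0..<T}" "u \<in> {0..<T}" for t u
    using field_differentiable_bound[of "{0..<T}" _ D C t u, OF _ deriv] bound that by simp
  then show ?thesis
    by blast
qed

text \<open>
  The gap in height keeps the group \<open>A\<close> at a distance from the other vortices, which alone change the
  impulse of \<open>A\<close>. At this distance the flux into a vortex is at most a constant times its own height, so
  the logarithm of the impulse of \<open>A\<close> has a bounded derivative.
\<close>

lemma low_group_impulse_bounded_below:
  assumes A: "A \<subseteq> I" "A \<noteq> {}" and t0: "t0 \<in> {0..<T}" and \<eta>: "0 < \<eta>"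
    and gap: "\<And>t i j. \<lbrakk>t \<in> {t0..<T}; i \<in> A; j \<in> I - A\<rbrakk> \<Longrightarrow> 2 * \<eta> \<le> height j t - height i t"
  shows "\<exists>\<delta>>0. \<forall>t\<in>{t0..<T}. \<delta> \<le> (\<Sum>i\<in>A. a i * height i t)"
proof -
  define Y where "Y t = (\<Sum>i\<in>A. a i * height i t)" for t
  define C where "C = (\<Sum>j\<in>I - A. a j * (height_bound / \<eta> ^ 3))"
  define D where "D t = (\<Sum>i\<in>A. a i * (\<Sum>j\<in>I - {i}. a j * flux (z i t) (z j t)))" for t
  have finA: "Finite_Set.finite A"
    using A finite finite_subset by blast
  have sub: "t \<in> {0..<T}" if "t \<in> {t0..<T}" for t
    using that t0 by auto
  have Y_pos: "0 < Y t" if "t \<in> {t0..<T}" for t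
    unfolding Y_def using A finA a_pos height_pos sub[OF that] by (intro sum_pos) auto
  have Y_deriv: "(Y has_real_derivative D t) (at t within {t0..<T})" if "t \<in> {t0..<T}" for t
  proof -
    have "(Y has_real_derivative D t) (at t within {0..<T})"
      unfolding Y_def D_def using A height_derivative sub[OF that]
      by (intro DERIV_sum DERIV_cmult) auto
    then show ?thesis
      by (rule DERIV_subset) (use t0 in auto)
  qed
  have bound: "\<bar>D t\<bar> \<le> C * Y t" if t: "t \<in> {t0..<T}" for t
  proof -
    have "(\<Sum>j\<in>I - {i}. a j * flux (z i t) (z j t)) =
        (\<Sum>j\<in>A - {i}. a j * flux (z i t) (z j t)) + (\<Sum>j\<in>I - A. a j * flux (z i t) (z j t))"
      if "i \<in> A" for i
    proof -
      have "I - {i} = (A - {i}) \<union> (I - A)"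
        using that A by auto
      then show ?thesis
        using finA finite by (auto intro!: sum.union_disjoint)
    qed
    then have "D t = (\<Sum>i\<in>A. a i * (\<Sum>j\<in>A - {i}. a j * flux (z i t) (z j t)))
        + (\<Sum>i\<in>A. a i * (\<Sum>j\<in>I - A. a j * flux (z i t) (z j t)))"
      by (simp add: D_def distrib_left sum.distrib)
    also have "(\<Sum>i\<in>A. a i * (\<Sum>j\<in>A - {i}. a j * flux (z i t) (z j t))) = 0"
      using weighted_flux_sum[OF A(1), of "\<lambda>_. 1" "\<lambda>i. z i t"] by simp
    finally have "\<bar>D t\<bar> \<le> (\<Sum>i\<in>A. \<bar>a i * (\<Sum>j\<in>I - A. a j * flux (z i t) (z j t))\<bar>)"
      by simp
    also have "\<dots> \<le> (\<Sum>i\<in>A. a i * height i t * C)"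
    proof (intro sum_mono)
      fix i assume i: "i \<in> A"
      then have iI: "i \<in> I"
        using A by auto
      have "\<bar>\<Sum>j\<in>I - A. a j * flux (z i t) (z j t)\<bar> \<le> (\<Sum>j\<in>I - A. height i t * (a j * (height_bound / \<eta> ^ 3)))"
      proof (intro order_trans[OF sum_abs] sum_mono)
        fix j assume j: "j \<in> I - A"
        have dom: "z i t \<in> \<Omega>" "z j t \<in> \<Omega>"
          using in_domain iI j sub[OF t] by auto
        have "2 * \<eta> \<le> 2 * norm (z i t - z j t)"
          using gap[OF t i j] s_diff_le[OF dom] by simp
        then have "\<bar>flux (z i t) (z j t)\<bar> \<le> height i t * height j t / \<eta> ^ 3"
          using \<eta> by (intro abs_flux_le_separated dom) auto
        also have "\<dots> \<le> height i t * height_bound / \<eta> ^ 3"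
          using \<eta> height_pos[OF iI sub[OF t]] height_le[OF _ sub[OF t], of j] j
          by (intro divide_right_mono mult_left_mono) auto
        finally have le: "\<bar>flux (z i t) (z j t)\<bar> \<le> height i t * height_bound / \<eta> ^ 3" .
        have "0 < a j"
          using a_pos j by simp
        then have "\<bar>a j * flux (z i t) (z j t)\<bar> = a j * \<bar>flux (z i t) (z j t)\<bar>"
          by (simp add: abs_mult)
        also have "\<dots> \<le> a j * (height i t * height_bound / \<eta> ^ 3)"
          using le \<open>0 < a j\<close> by (intro mult_left_mono) auto
        finally show "\<bar>a j * flux (z i t) (z j t)\<bar> \<le> height i t * (a j * (height_bound / \<eta> ^ 3))"
          by (simp add: mult_ac)
      qed
      then have "\<bar>\<Sum>j\<in>I - A. a j * flux (z i t) (z j t)\<bar> \<le> height i t * C"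
        by (simp add: C_def sum_distrib_left)
      then show "\<bar>a i * (\<Sum>j\<in>I - A. a j * flux (z i t) (z j t))\<bar> \<le> a i * height i t * C"
        using a_pos[OF iI] mult_left_mono[of _ "height i t * C" "a i"] by (simp add: abs_mult mult.assoc)
    qed
    also have "\<dots> = C * Y t"
      by (simp add: Y_def sum_distrib_left mult_ac)
    finally show ?thesis .
  qed
  define \<delta> where "\<delta> = exp (ln (Y t0) - C * T)"
  have "\<delta> \<le> Y t" if t: "t \<in> {t0..<T}" for t
  proof -
    have "((\<lambda>t. ln (Y t)) has_real_derivative 1 / Y u * D u) (at u within {t0..<T})"
      if "u \<in> {t0..<T}" for u
      using DERIV_chain2[OF DERIV_ln_divide[OF Y_pos[OF that]] Y_deriv[OF that]] .
    moreover have "norm (1 / Y u * D u) \<le> C" if "u \<in> {t0..<T}" for u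
      using bound[OF that] Y_pos[OF that] by (simp add: abs_mult field_simps)
    ultimately have "norm (ln (Y t) - ln (Y t0)) \<le> C * norm (t - t0)"
      using t t0 by (intro field_differentiable_bound[of "{t0..<T}"]) auto
    also have "0 \<le> C"
      using bound[OF t] Y_pos[OF t] by (meson abs_ge_zero order_trans zero_le_mult_iff not_le)
    then have "C * norm (t - t0) \<le> C * T"
      using t t0 by (intro mult_left_mono) auto
    finally have "ln (Y t0) - C * T \<le> ln (Y t)"
      by simp
    then show ?thesis
      using Y_pos[OF t] by (metis \<delta>_def exp_le_cancel_iff exp_ln)
  qed
  moreover have "0 < \<delta>"
    by (simp add: \<delta>_def)
  ultimately show ?thesis
    unfolding Y_def by blast
qed

lemma height_bounded_below_before:
  assumes "0 \<le> u" "u < T"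
  shows "\<exists>\<delta>>0. \<forall>i\<in>I. \<forall>t\<in>{0..u}. \<delta> \<le> height i t"
proof -
  have "\<exists>\<delta>>0. \<forall>t\<in>{0..u}. \<delta> \<le> height i t" if i: "i \<in> I" for i
  proof -
    have "continuous_on {0..u} (height i)"
      using continuous_height[OF i] by (rule continuous_on_subset) (use assms in auto)
    then obtain m where m: "m \<in> {0..u}" "\<forall>t\<in>{0..u}. height i m \<le> height i t"
      using continuous_attains_inf[of "{0..u}" "height i"] assms by auto
    then show ?thesis
      using height_pos[OF i, of m] assms by auto
  qed
  then obtain d where d: "\<And>i. i \<in> I \<Longrightarrow> 0 < d i \<and> (\<forall>t\<in>{0..u}. d i \<le> height i t)"
    by metis
  define \<delta> where "\<delta> = Min (insert 1 (d ` I))"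
  have "0 < \<delta>"
    unfolding \<delta>_def using finite d by (subst Min_gr_iff) auto
  moreover have "\<delta> \<le> d i" if "i \<in> I" for i
    unfolding \<delta>_def using finite that by (intro Min_le) auto
  ultimately show ?thesis
    using d by (meson order_trans)
qed

text \<open>
  The compactness argument: heights that come close to \<open>0\<close> would produce, near time \<open>T\<close>, a low group separated
  by a gap from the other vortices and whose impulse tends to \<open>0\<close> along a sequence of times, contrary to
  \<open>low_group_impulse_bounded_below\<close>.
\<close>

theorem height_bounded_below: "\<exists>\<delta>>0. \<forall>i\<in>I. \<forall>t\<in>{0..<T}. \<delta> \<le> height i t"
proof (rule ccontr)
  assume contr: "\<not> ?thesis"
  have low: "\<exists>t. \<exists>i\<in>I. u < t \<and> t < T \<and> height i t < \<epsilon>" if u: "0 \<le> u" "u < T" and \<epsilon>: "0 < \<epsilon>" for u \<epsilon>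
  proof -
    obtain \<delta> where \<delta>: "0 < \<delta>" "\<forall>i\<in>I. \<forall>t\<in>{0..u}. \<delta> \<le> height i t"
      using height_bounded_below_before[OF u] by blast
    then have "0 < min \<delta> \<epsilon>"
      using \<epsilon> by simp
    then obtain i t where "i \<in> I" "t \<in> {0..<T}" "height i t < min \<delta> \<epsilon>"
      using contr by (meson not_le)
    then show ?thesis
      using \<delta>(2) by (intro exI[of _ t] bexI[of _ i]) force+
  qed
  have "\<forall>n. \<exists>t. \<exists>i\<in>I. T - T / Suc n < t \<and> t < T \<and> height i t < 1 / Suc n"
    using T_pos by (intro allI low) (auto simp: field_simps)
  then obtain \<tau> \<iota> where \<tau>: "\<And>n. \<iota> n \<in> I" "\<And>n. T - T / Suc n < \<tau> n" "\<And>n. \<tau> n < T"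
      "\<And>n. height (\<iota> n) (\<tau> n) < 1 / Suc n"
    by metis
  have \<tau>_in: "\<tau> n \<in> {0..<T}" for n
  proof -
    have "T / Suc n \<le> T / 1"
      using T_pos by (intro divide_left_mono) auto
    then show ?thesis
      using \<tau>(2)[of n] \<tau>(3)[of n] by simp
  qed
  have "height i (\<tau> n) \<in> {0..height_bound}" if "i \<in> I" for i n
    using height_le[OF that \<tau>_in] height_pos[OF that \<tau>_in] by (simp add: less_imp_le)
  then obtain r c where r: "strict_mono (r :: nat \<Rightarrow> nat)"
    and c: "\<And>i. i \<in> I \<Longrightarrow> (\<lambda>n. height i (\<tau> (r n))) \<longlonglongrightarrow> c i"
    using convergent_subsequence_finite_family[OF finite, of "\<lambda>i n. height i (\<tau> n)" height_bound]
    by blast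
  have inv: "(\<lambda>n. K / real (Suc (r n))) \<longlonglongrightarrow> 0" for K
  proof -
    have "(\<lambda>n. K * inverse (real (Suc n))) \<longlonglongrightarrow> K * 0"
      by (intro tendsto_intros LIMSEQ_inverse_real_of_nat)
    then show ?thesis
      using LIMSEQ_subseq_LIMSEQ[OF _ r] by (simp add: o_def divide_inverse)
  qed
  have \<tau>_lim: "(\<lambda>n. \<tau> (r n)) \<longlonglongrightarrow> T"
  proof (rule tendsto_sandwich)
    show "(\<lambda>n. T - T / real (Suc (r n))) \<longlonglongrightarrow> T"
      using tendsto_diff[OF tendsto_const inv] by simp
  qed (use \<tau>(2,3) in \<open>auto intro!: always_eventually less_imp_le\<close>)
  \<comment> \<open>A polynomial that vanishes exactly at the limit heights; squares make it nonnegative, so that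
    a small moment forces every height to be near one of them.\<close>
  define p where "p = (\<Prod>j\<in>I. [:- c j, 1:]\<^sup>2)"
  have p: "poly p \<sigma> = (\<Prod>j\<in>I. (\<sigma> - c j)\<^sup>2)" for \<sigma>
    by (simp add: p_def poly_prod)
  have p_nonneg: "0 \<le> poly p \<sigma>" for \<sigma>
    by (simp add: p prod_nonneg)
  define F where "F t = (\<Sum>i\<in>I. a i * poly p (height i t))" for t
  obtain C where C: "\<And>t u. \<lbrakk>t \<in> {0..<T}; u \<in> {0..<T}\<rbrakk> \<Longrightarrow> \<bar>F t - F u\<bar> \<le> C * \<bar>t - u\<bar>"
    using polynomial_height_moment_lipschitz[of p] unfolding F_def by blast
  have "(\<lambda>n. F (\<tau> (r n))) \<longlonglongrightarrow> (\<Sum>i\<in>I. a i * poly p (c i))"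
    unfolding F_def using c by (intro tendsto_intros) auto
  also have "(\<Sum>i\<in>I. a i * poly p (c i)) = 0"
    using finite by (auto simp: p intro!: sum.neutral)
  finally have F0: "(\<lambda>n. F (\<tau> (r n))) \<longlonglongrightarrow> 0" .
  have F_le: "F t \<le> C * (T - t)" if t: "t \<in> {0..<T}" for t
  proof (rule LIMSEQ_le_const)
    have "(\<lambda>n. C * \<bar>t - \<tau> (r n)\<bar> + F (\<tau> (r n))) \<longlonglongrightarrow> C * \<bar>t - T\<bar> + 0"
      by (intro tendsto_intros \<tau>_lim F0)
    then show "(\<lambda>n. C * \<bar>t - \<tau> (r n)\<bar> + F (\<tau> (r n))) \<longlonglongrightarrow> C * (T - t)"
      using t by simp
    show "\<exists>N. \<forall>n\<ge>N. F t \<le> C * \<bar>t - \<tau> (r n)\<bar> + F (\<tau> (r n))"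
      using C[OF t \<tau>_in] by (intro exI[of _ 0]) (auto simp: abs_le_iff algebra_simps)
  qed
  have c_nonneg: "0 \<le> c i" if "i \<in> I" for i
    by (rule LIMSEQ_le_const[OF c[OF that]]) (use height_pos[OF that \<tau>_in] in \<open>auto intro: less_imp_le\<close>)
  \<comment> \<open>No limit height lies in \<open>[\<eta>, 3 * \<eta>]\<close>, so \<open>p\<close> is bounded away from \<open>0\<close> there.\<close>
  define P where "P = c ` I - {0}"
  define \<eta> where "\<eta> = Min (insert 1 P) / 4"
  have P_pos: "0 < \<sigma>" if "\<sigma> \<in> P" for \<sigma>
    using that c_nonneg by (force simp: P_def)
  have \<eta>: "0 < \<eta>"
    using finite P_pos by (auto simp: \<eta>_def P_def)
  have \<eta>_le: "4 * \<eta> \<le> \<sigma>" if "\<sigma> \<in> P" for \<sigma>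
    using finite that by (simp add: \<eta>_def P_def)
  have avoid: "\<exists>m>0. \<forall>\<sigma>\<in>{\<eta>..3 * \<eta>}. m \<le> poly p \<sigma>"
  proof -
    obtain \<mu> where \<mu>: "\<mu> \<in> {\<eta>..3 * \<eta>}" "\<forall>\<sigma>\<in>{\<eta>..3 * \<eta>}. poly p \<mu> \<le> poly p \<sigma>"
    proof -
      have "continuous_on {\<eta>..3 * \<eta>} (poly p)"
        by (intro continuous_intros)
      then show ?thesis
        using continuous_attains_inf[of "{\<eta>..3 * \<eta>}" "poly p"] \<eta> that by auto
    qed
    have "\<mu> \<noteq> c j" if "j \<in> I" for j
      using \<eta>_le[of "c j"] \<mu>(1) that \<eta> by (cases "c j = 0") (auto simp: P_def)
    then have "0 < poly p \<mu>"
      unfolding p by (intro prod_pos) auto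
    then show ?thesis
      using \<mu> by blast
  qed
  then obtain m where m: "0 < m" "\<And>\<sigma>. \<sigma> \<in> {\<eta>..3 * \<eta>} \<Longrightarrow> m \<le> poly p \<sigma>"
    by blast
  define \<alpha> where "\<alpha> = Min (insert 1 (a ` I))"
  have \<alpha>: "0 < \<alpha>" "\<And>i. i \<in> I \<Longrightarrow> \<alpha> \<le> a i"
    using finite a_pos by (auto simp: \<alpha>_def)
  define K where "K = \<bar>C\<bar> + 1"
  have K: "0 < K" "C \<le> K"
    by (auto simp: K_def)
  \<comment> \<open>From \<open>t0\<close> on, the moment is below the value that a single height in \<open>[\<eta>, 3 * \<eta>]\<close> would
    contribute.\<close>
  define t0 where "t0 = max 0 (T - \<alpha> * m / (2 * K))"
  have t0: "t0 \<in> {0..<T}"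
    using T_pos \<alpha> m K by (auto simp: t0_def)
  have "height i t \<notin> {\<eta>..3 * \<eta>}" if i: "i \<in> I" and t: "t \<in> {t0..<T}" for i t
  proof
    assume "height i t \<in> {\<eta>..3 * \<eta>}"
    then have "\<alpha> * m \<le> a i * poly p (height i t)"
      using \<alpha> m i by (intro mult_mono) (auto intro: less_imp_le[OF a_pos])
    also have "\<dots> \<le> F t"
      unfolding F_def using finite i a_pos p_nonneg
      by (intro member_le_sum) (auto intro!: mult_nonneg_nonneg less_imp_le[OF a_pos])
    also have "\<dots> \<le> C * (T - t)"
      using t t0 by (intro F_le) auto
    also have "\<dots> \<le> K * (T - t)"
      using t K by (intro mult_right_mono) auto
    also have "\<dots> \<le> K * (\<alpha> * m / (2 * K))"
      using t K by (intro mult_left_mono) (auto simp: t0_def)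
    also have "\<dots> = \<alpha> * m / 2"
      using K by simp
    finally show False
      using \<alpha>(1) m(1) by (simp add: mult_le_0_iff)
  qed
  then have sides: "height i t < \<eta> \<or> 3 * \<eta> < height i t" if "i \<in> I" "t \<in> {t0..<T}" for i t
    using that by fastforce
  define A where "A = {i \<in> I. height i t0 < \<eta>}"
  have same_side: "height i u < \<eta> \<longleftrightarrow> height i t < \<eta>"
    if i: "i \<in> I" and ut: "t0 \<le> u" "u \<le> t" "t < T" for i u t
  proof -
    have "continuous_on {u..t} (height i)"
      using continuous_height[OF i] by (rule continuous_on_subset) (use t0 ut in auto)
    then have "connected (height i ` {u..t})"
      by (intro connected_continuous_image) auto
    then have "\<And>x y. \<lbrakk>x \<in> height i ` {u..t}; y \<in> height i ` {u..t}; x \<le> 2 * \<eta>; 2 * \<eta> \<le> y\<rbrakk>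
        \<Longrightarrow> 2 * \<eta> \<in> height i ` {u..t}"
      unfolding connected_iff_interval by blast
    moreover have "2 * \<eta> \<notin> height i ` {u..t}"
    proof
      assume "2 * \<eta> \<in> height i ` {u..t}"
      then obtain w where "w \<in> {u..t}" "height i w = 2 * \<eta>"
        by (metis imageE)
      then show False
        using sides[OF i, of w] ut \<eta> by simp
    qed
    ultimately show ?thesis
      using sides[OF i, of u] sides[OF i, of t] ut \<eta>
      by (smt (verit, best) atLeastAtMost_iff atLeastLessThan_iff image_eqI)
  qed
  have in_A: "height i t < \<eta>" if "i \<in> A" "t \<in> {t0..<T}" for i t
    using same_side[of i t0 t] that by (auto simp: A_def)
  have not_A: "3 * \<eta> < height i t" if "i \<in> I - A" "t \<in> {t0..<T}" for i t
    using same_side[of i t0 t] sides[of i t] that by (auto simp: A_def)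
  have late: "\<forall>\<^sub>F n in sequentially. \<tau> (r n) \<in> {t0..<T}"
    using order_tendstoD(1)[OF \<tau>_lim, of t0] t0 \<tau>(3) by (auto elim: eventually_mono)
  have "\<forall>\<^sub>F n in sequentially. 1 / real (Suc (r n)) < \<eta>"
    using order_tendstoD(2)[OF inv \<eta>] .
  with late have "\<forall>\<^sub>F n in sequentially. \<iota> (r n) \<in> A"
  proof eventually_elim
    case (elim n)
    then show ?case
      using not_A[of "\<iota> (r n)" "\<tau> (r n)"] \<tau>(1)[of "r n"] \<tau>(4)[of "r n"] \<eta> by fastforce
  qed
  then have "A \<noteq> {}"
    using eventually_happens'[OF sequentially_bot] by blast
  moreover have "2 * \<eta> \<le> height j t - height i t" if "t \<in> {t0..<T}" "i \<in> A" "j \<in> I - A" for t i j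
    using in_A[OF that(2,1)] not_A[OF that(3,1)] by simp
  ultimately obtain \<delta> where \<delta>: "0 < \<delta>" "\<forall>t\<in>{t0..<T}. \<delta> \<le> (\<Sum>i\<in>A. a i * height i t)"
    using low_group_impulse_bounded_below[of A t0 \<eta>] t0 \<eta> by (auto simp: A_def)
  have c0: "c i = 0" if "i \<in> A" for i
  proof (rule ccontr)
    assume "c i \<noteq> 0"
    have "i \<in> I"
      using that by (simp add: A_def)
    have "c i \<le> \<eta>"
      using late by (intro tendsto_upperbound[OF c[OF \<open>i \<in> I\<close>]])
        (auto elim!: eventually_mono intro!: less_imp_le in_A that)
    then show False
      using \<eta>_le[of "c i"] \<open>c i \<noteq> 0\<close> \<open>i \<in> I\<close> \<eta> by (simp add: P_def)
  qed
  have "(\<lambda>n. height i (\<tau> (r n))) \<longlonglongrightarrow> 0" if "i \<in> A" for i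
    using c[of i] c0[OF that] that by (simp add: A_def)
  then have "(\<lambda>n. \<Sum>i\<in>A. a i * height i (\<tau> (r n))) \<longlonglongrightarrow> (\<Sum>i\<in>A. a i * 0)"
    by (intro tendsto_intros)
  then have "\<delta> \<le> (\<Sum>i\<in>A. a i * 0)"
    using late \<delta>(2) by (intro tendsto_lowerbound[where F = sequentially]) (auto elim!: eventually_mono)
  then show False
    using \<delta>(1) by simp
qed

text \<open>
  The Hamiltonian of the system: the velocity of vortex \<open>i\<close> is \<open>\<i> / a i\<close> times its gradient in the
  position of that vortex.
\<close>

definition energy :: "real \<Rightarrow> real" where
  "energy t = (\<Sum>i\<in>I. \<Sum>j\<in>I - {i}. a i * a j / 2 * green (z i t) (z j t))
     + (\<Sum>i\<in>I. (a i)\<^sup>2 / 2 * robin_fun (z i t))"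

text \<open>
  Each vortex moves orthogonally to the gradient of the energy in its own position.
\<close>

lemma energy_conserved:
  assumes t: "t \<in> {0..<T}"
  shows "energy t = energy 0"
proof -
  have "(energy has_real_derivative 0) (at t within {0..<T})" if t: "t \<in> {0..<T}" for t
  proof -
    define v where "v i = velocity I a (\<lambda>j. z j t) i" for i
    define w where "w i = (\<Sum>j\<in>I - {i}. a j *\<^sub>R pair_grad (z i t) (z j t)) + (a i / 2) *\<^sub>R self_grad (z i t)" for i
    define h where "h i j = a i * a j / 2 * inner (pair_grad (z i t) (z j t)) (v i)" for i j
    have "(energy has_real_derivative
        (\<Sum>i\<in>I. \<Sum>j\<in>I - {i}. a i * a j / 2 * (inner (pair_grad (z i t) (z j t)) (v i)
            + inner (pair_grad (z j t) (z i t)) (v j)))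
        + (\<Sum>i\<in>I. (a i)\<^sup>2 / 2 * inner (self_grad (z i t)) (v i))) (at t within {0..<T})"
      unfolding energy_def v_def using t in_domain distinct
      by (intro DERIV_add DERIV_sum DERIV_cmult green_curve_derivative robin_curve_derivative motion) auto
    moreover have "(\<Sum>i\<in>I. \<Sum>j\<in>I - {i}. a i * a j / 2 * (inner (pair_grad (z i t) (z j t)) (v i)
            + inner (pair_grad (z j t) (z i t)) (v j)))
        + (\<Sum>i\<in>I. (a i)\<^sup>2 / 2 * inner (self_grad (z i t)) (v i)) = 0"
    proof -
      have "(\<Sum>i\<in>I. \<Sum>j\<in>I - {i}. a i * a j / 2 * (inner (pair_grad (z i t) (z j t)) (v i)
            + inner (pair_grad (z j t) (z i t)) (v j))) = (\<Sum>i\<in>I. \<Sum>j\<in>I - {i}. h i j + h j i)"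
        by (simp add: h_def algebra_simps)
      also have "\<dots> = 2 * (\<Sum>i\<in>I. \<Sum>j\<in>I - {i}. h i j)"
        using sum_off_diagonal_swap[OF finite, of h] by (simp add: sum.distrib)
      also have "\<dots> = (\<Sum>i\<in>I. a i * inner (\<Sum>j\<in>I - {i}. a j *\<^sub>R pair_grad (z i t) (z j t)) (v i))"
        by (simp add: h_def sum_distrib_left inner_sum_left mult_ac)
      finally have "(\<Sum>i\<in>I. \<Sum>j\<in>I - {i}. a i * a j / 2 * (inner (pair_grad (z i t) (z j t)) (v i)
            + inner (pair_grad (z j t) (z i t)) (v j)))
        + (\<Sum>i\<in>I. (a i)\<^sup>2 / 2 * inner (self_grad (z i t)) (v i)) = (\<Sum>i\<in>I. a i * inner (w i) (v i))"
        by (simp add: w_def inner_add_left sum.distrib[symmetric] power2_eq_square algebra_simps)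
      also have "\<dots> = 0"
        by (simp add: v_def velocity_def w_def[symmetric] inner_rotate_self)
      finally show ?thesis .
    qed
    ultimately show ?thesis
      by simp
  qed
  then have "\<exists>c. \<forall>t\<in>{0..<T}. energy t = c"
    by (intro has_field_derivative_zero_constant) auto
  then show ?thesis
    using t T_pos by auto
qed

text \<open>
  The heights being bounded below, the energy bounds the sum of the positive terms
  \<open>- a i * a j / 2 * green (z i) (z j)\<close>, hence each of them. A bound on \<open>green x y\<close> from below is a
  bound from below on \<open>norm (x - y) / norm (B x y)\<close>.
\<close>

theorem distance_bounded_below:
  "\<exists>\<delta>>0. \<forall>i\<in>I. \<forall>j\<in>I. \<forall>t\<in>{0..<T}. i \<noteq> j \<longrightarrow> \<delta> \<le> norm (z i t - z j t)"
proof -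
  obtain \<delta> where \<delta>: "0 < \<delta>" "\<And>i t. \<lbrakk>i \<in> I; t \<in> {0..<T}\<rbrakk> \<Longrightarrow> \<delta> \<le> height i t"
    using height_bounded_below by blast
  define R where "R = (\<Sum>i\<in>I. (a i)\<^sup>2 / 2 * (- 1 / (2 * pi) * ln \<delta>))"
  define Q where "Q = R - energy 0"
  define q where "q i j = 2 * pi * (Q / (a i * a j / 2))" for i j
  have "\<delta> * exp (- q i j) \<le> norm (z i t - z j t)"
    if ij: "i \<in> I" "j \<in> I" "i \<noteq> j" and t: "t \<in> {0..<T}" for i j t
  proof -
    have nonpos: "green (z k t) (z l t) \<le> 0" if "k \<in> I" "l \<in> I" "k \<noteq> l" for k l
    proof -
      have "norm (z k t - z l t) / norm (B (z k t) (z l t)) \<le> 1"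
        using norm_diff_le_norm_B[OF in_domain[OF that(1) t] in_domain[OF that(2) t]]
        by (simp add: divide_le_eq_1)
      then have "ln (norm (z k t - z l t) / norm (B (z k t) (z l t))) \<le> 0"
        using distinct[OF that t] norm_B_pos[OF in_domain[OF that(1) t] in_domain[OF that(2) t]]
        by simp
      then show ?thesis
        by (simp add: green_def mult_le_0_iff divide_le_0_iff)
    qed
    have nn: "0 \<le> a k * a l / 2 * - green (z k t) (z l t)" if "k \<in> I" "l \<in> I" "k \<noteq> l" for k l
      using nonpos[OF that] a_pos[OF that(1)] a_pos[OF that(2)] by (intro mult_nonneg_nonneg) auto
    have "a i * a j / 2 * - green (z i t) (z j t) \<le> (\<Sum>l\<in>I - {i}. a i * a l / 2 * - green (z i t) (z l t))"
      using ij nn finite by (intro member_le_sum) auto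
    also have "\<dots> \<le> (\<Sum>k\<in>I. \<Sum>l\<in>I - {k}. a k * a l / 2 * - green (z k t) (z l t))"
      using ij nn finite
      by (intro member_le_sum[where f = "\<lambda>k. \<Sum>l\<in>I - {k}. a k * a l / 2 * - green (z k t) (z l t)"] sum_nonneg) auto
    also have "\<dots> = (\<Sum>k\<in>I. (a k)\<^sup>2 / 2 * robin_fun (z k t)) - energy t"
      by (simp add: energy_def sum_negf)
    also have "\<dots> \<le> Q"
      unfolding Q_def R_def energy_conserved[OF t]
    proof (intro diff_right_mono sum_mono mult_left_mono)
      fix k assume k: "k \<in> I"
      have "ln \<delta> \<le> ln (height k t)"
        using \<delta>(1) \<delta>(2)[OF k t] by simp
      then show "robin_fun (z k t) \<le> - 1 / (2 * pi) * ln \<delta>"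
        unfolding robin_fun_def by (intro mult_left_mono_neg) auto
    qed simp
    finally have "- green (z i t) (z j t) \<le> Q / (a i * a j / 2)"
      using a_pos ij by (simp add: field_simps)
    then have "2 * pi * - green (z i t) (z j t) \<le> q i j"
      unfolding q_def by (intro mult_left_mono) auto
    then have "- q i j \<le> 2 * pi * green (z i t) (z j t)"
      by simp
    also have "\<dots> = ln (norm (z i t - z j t) / norm (B (z i t) (z j t)))"
      by (simp add: green_def)
    finally have "exp (- q i j) \<le> norm (z i t - z j t) / norm (B (z i t) (z j t))"
      using distinct[OF ij t] norm_B_pos[OF in_domain[OF ij(1) t] in_domain[OF ij(2) t]]
      by (subst (asm) ln_ge_iff) auto
    then have "exp (- q i j) * norm (B (z i t) (z j t)) \<le> norm (z i t - z j t)"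
      using norm_B_pos[OF in_domain[OF ij(1) t] in_domain[OF ij(2) t]] by (simp add: field_simps)
    moreover have "\<delta> \<le> norm (B (z i t) (z j t))"
    proof (rule power2_le_imp_le)
      have "\<delta>\<^sup>2 \<le> height i t * height j t"
        unfolding power2_eq_square using \<delta> ij t by (intro mult_mono) (auto intro: less_imp_le[OF height_pos])
      then show "\<delta>\<^sup>2 \<le> (norm (B (z i t) (z j t)))\<^sup>2"
        using s_mult_le_norm_B order_trans by blast
    qed simp
    then have "exp (- q i j) * \<delta> \<le> exp (- q i j) * norm (B (z i t) (z j t))"
      by (intro mult_left_mono) auto
    ultimately have "exp (- q i j) * \<delta> \<le> norm (z i t - z j t)"
      by (rule order_trans[rotated])
    then show ?thesis
      by (simp add: mult.commute)
  qed
  moreover define \<mu> where "\<mu> = Min (insert 1 ((\<lambda>(i, j). \<delta> * exp (- q i j)) ` (I \<times> I)))"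
  moreover have "0 < \<mu>"
    using finite \<delta>(1) by (auto simp: \<mu>_def)
  moreover have "\<mu> \<le> \<delta> * exp (- q i j)" if "i \<in> I" "j \<in> I" for i j
    unfolding \<mu>_def using finite that by (intro Min_le) auto
  ultimately show ?thesis
    by (meson order_trans)
qed

end

section \<open>The vector field on a Banach space of configurations\<close>

text \<open>
  Boundedness is part of the notion so that it is preserved by products.
\<close>

definition lip_bdd :: "'a::metric_space set \<Rightarrow> ('a \<Rightarrow> complex) \<Rightarrow> bool" where
  "lip_bdd S \<phi> \<longleftrightarrow> (\<exists>M. \<forall>w\<in>S. norm (\<phi> w) \<le> M) \<and> (\<exists>L. L-lipschitz_on S \<phi>)"

lemma lip_bdd_const: "lip_bdd S (\<lambda>_. c)"
  unfolding lip_bdd_def using lipschitz_on_constant by blast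

lemma lip_bdd_add:
  assumes "lip_bdd S \<phi>" "lip_bdd S \<psi>"
  shows "lip_bdd S (\<lambda>w. \<phi> w + \<psi> w)"
proof -
  obtain M M' L L' where "\<forall>w\<in>S. norm (\<phi> w) \<le> M" "\<forall>w\<in>S. norm (\<psi> w) \<le> M'"
    "L-lipschitz_on S \<phi>" "L'-lipschitz_on S \<psi>"
    using assms unfolding lip_bdd_def by blast
  then have "\<forall>w\<in>S. norm (\<phi> w + \<psi> w) \<le> M + M'" "(L + L')-lipschitz_on S (\<lambda>w. \<phi> w + \<psi> w)"
    by (auto intro: norm_triangle_mono lipschitz_on_add)
  then show ?thesis
    unfolding lip_bdd_def by blast
qed

lemma lip_bdd_mult:
  assumes "lip_bdd S \<phi>" "lip_bdd S \<psi>"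
  shows "lip_bdd S (\<lambda>w. \<phi> w * \<psi> w)"
proof -
  obtain M M' L L' where M: "\<forall>w\<in>S. norm (\<phi> w) \<le> M" "\<forall>w\<in>S. norm (\<psi> w) \<le> M'"
    and L: "L-lipschitz_on S \<phi>" "L'-lipschitz_on S \<psi>"
    using assms unfolding lip_bdd_def by blast
  note L0 = lipschitz_on_nonneg[OF L(1)] lipschitz_on_nonneg[OF L(2)]
  have "norm (\<phi> w * \<psi> w) \<le> \<bar>M\<bar> * \<bar>M'\<bar>" if "w \<in> S" for w
    unfolding norm_mult using M that by (intro mult_mono) force+
  moreover have "(\<bar>M\<bar> * L' + L * \<bar>M'\<bar>)-lipschitz_on S (\<lambda>w. \<phi> w * \<psi> w)"
  proof (rule lipschitz_onI)
    fix v w assume vw: "v \<in> S" "w \<in> S"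
    have "norm (\<phi> v * \<psi> v - \<phi> w * \<psi> w) = norm (\<phi> v * (\<psi> v - \<psi> w) + (\<phi> v - \<phi> w) * \<psi> w)"
      by (simp add: algebra_simps)
    also have "\<dots> \<le> norm (\<phi> v) * norm (\<psi> v - \<psi> w) + norm (\<phi> v - \<phi> w) * norm (\<psi> w)"
      by (metis norm_mult norm_triangle_ineq)
    also have "\<dots> \<le> \<bar>M\<bar> * (L' * dist v w) + (L * dist v w) * \<bar>M'\<bar>"
      using lipschitz_onD[OF L(1) vw] lipschitz_onD[OF L(2) vw] M vw L0
      by (intro add_mono mult_mono) (force simp: dist_norm)+
    finally show "dist (\<phi> v * \<psi> v) (\<phi> w * \<psi> w) \<le> (\<bar>M\<bar> * L' + L * \<bar>M'\<bar>) * dist v w"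
      by (simp add: dist_norm algebra_simps)
  qed (use L0 in auto)
  ultimately show ?thesis
    unfolding lip_bdd_def by blast
qed

lemma lip_bdd_sum:
  assumes "finite J" "\<And>j. j \<in> J \<Longrightarrow> lip_bdd S (\<phi> j)"
  shows "lip_bdd S (\<lambda>w. \<Sum>j\<in>J. \<phi> j w)"
  using assms by (induction J rule: finite_induct) (auto intro: lip_bdd_const lip_bdd_add)

lemma lip_bdd_inverse_cnj:
  assumes lip: "L-lipschitz_on S \<phi>" and c: "0 < c" "\<And>w. w \<in> S \<Longrightarrow> c \<le> norm (\<phi> w)"
  shows "lip_bdd S (\<lambda>w. 1 / cnj (\<phi> w))"
proof -
  have "norm (1 / cnj (\<phi> w)) \<le> 1 / c" if "w \<in> S" for w
    using c(1) c(2)[OF that] by (auto simp: norm_divide intro!: frac_le)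
  moreover have "(L / (c * c))-lipschitz_on S (\<lambda>w. 1 / cnj (\<phi> w))"
  proof (rule lipschitz_onI)
    fix v w assume vw: "v \<in> S" "w \<in> S"
    have nn: "0 \<le> L * dist v w"
      using lipschitz_on_nonneg[OF lip] by simp
    have pos: "0 < norm (\<phi> v)" "0 < norm (\<phi> w)"
      using c(1) c(2)[OF vw(1)] c(2)[OF vw(2)] by linarith+
    then have "1 / cnj (\<phi> v) - 1 / cnj (\<phi> w) = cnj (\<phi> w - \<phi> v) / (cnj (\<phi> v) * cnj (\<phi> w))"
      by (simp add: field_simps)
    then have "dist (1 / cnj (\<phi> v)) (1 / cnj (\<phi> w)) = dist (\<phi> v) (\<phi> w) / (norm (\<phi> v) * norm (\<phi> w))"
      by (simp add: dist_norm norm_divide norm_mult norm_minus_commute del: complex_cnj_diff)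
    also have "\<dots> \<le> (L * dist v w) / (c * c)"
      using c(1) c(2)[OF vw(1)] c(2)[OF vw(2)] pos nn lipschitz_onD[OF lip vw]
      by (intro frac_le mult_mono) auto
    finally show "dist (1 / cnj (\<phi> v)) (1 / cnj (\<phi> w)) \<le> L / (c * c) * dist v w"
      by simp
  qed (use c lipschitz_on_nonneg[OF lip] in auto)
  ultimately show ?thesis
    unfolding lip_bdd_def by blast
qed

lemma lip_bdd_scaleR: "lip_bdd S \<phi> \<Longrightarrow> lip_bdd S (\<lambda>w. c *\<^sub>R \<phi> w)"
  unfolding scaleR_conv_of_real by (intro lip_bdd_mult lip_bdd_const)

instance bcontfun :: (metric_space, banach) banach ..

lemma continuous_on_discrete_copy: "continuous_on UNIV (f :: 'i discrete \<Rightarrow> 'b::topological_space)"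
  by (simp add: continuous_on_open_vimage open_discrete)

text \<open>
  Configurations are bounded functions on the discrete space of indices with the supremum norm. The number
  of vortices then need not be encoded in a type; coordinates outside the index set are kept at \<open>0\<close>.
\<close>

definition coords :: "('i discrete \<Rightarrow>\<^sub>C 'b::metric_space) \<Rightarrow> 'i \<Rightarrow> 'b" where
  "coords w i = apply_bcontfun w (discrete i)"

definition from_coords :: "'i set \<Rightarrow> ('i \<Rightarrow> 'b) \<Rightarrow> ('i discrete \<Rightarrow>\<^sub>C 'b::real_normed_vector)" where
  "from_coords I f = Bcontfun (\<lambda>k. if of_discrete k \<in> I then f (of_discrete k) else 0)"

lemma coords_from_coords:
  assumes "finite I"
  shows "coords (from_coords I f) i = (if i \<in> I then f i else 0)"
proof -
  let ?f = "\<lambda>k. if of_discrete k \<in> I then f (of_discrete k) else 0"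
  have "range ?f \<subseteq> insert 0 (f ` I)"
    by auto
  then have "bounded (range ?f)"
    using assms by (meson bounded_subset finite_imageI finite_imp_bounded finite.insertI)
  then have "?f \<in> bcontfun"
    by (simp add: bcontfun_def continuous_on_discrete_copy)
  then show ?thesis
    by (simp add: coords_def from_coords_def Bcontfun_inverse discrete_inverse)
qed

lemma coords_dist: "dist (coords v i) (coords w i) \<le> dist v w"
  unfolding coords_def by (rule dist_bounded)

lemma dist_le_coords: "(\<And>i. dist (coords v i) (coords w i) \<le> c) \<Longrightarrow> dist v w \<le> c"
  unfolding coords_def by (metis dist_bound discrete_cases)

lemma norm_le_coords: "(\<And>i. norm (coords w i) \<le> c) \<Longrightarrow> norm w \<le> c"
  unfolding coords_def by (metis norm_bound discrete_cases)

lemma bounded_linear_coords: "bounded_linear (\<lambda>w. coords w i)"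
  by (rule bounded_linear_intro[of _ 1])
    (auto simp: coords_def norm_bounded)

context vortex_domain
begin

text \<open>
  The sets \<open>separated I \<epsilon>\<close> exhaust the configurations of distinct vortices as \<open>\<epsilon>\<close> tends to \<open>0\<close>,
  and the vector field is bounded and Lipschitz on each of them, although they need not be compact.
\<close>

definition separated :: "'i set \<Rightarrow> real \<Rightarrow> ('i discrete \<Rightarrow>\<^sub>C complex) set" where
  "separated I \<epsilon> = {w :: 'i discrete \<Rightarrow>\<^sub>C complex. \<forall>i\<in>I. \<epsilon> \<le> s (coords w i) \<and> (\<forall>j\<in>I. i \<noteq> j \<longrightarrow> \<epsilon> \<le> norm (coords w i - coords w j))}"

definition configurations :: "'i set \<Rightarrow> ('i discrete \<Rightarrow>\<^sub>C complex) set" where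
  "configurations I = {w :: 'i discrete \<Rightarrow>\<^sub>C complex. \<forall>i\<in>I. coords w i \<in> \<Omega> \<and> (\<forall>j\<in>I. i \<noteq> j \<longrightarrow> coords w i \<noteq> coords w j)}"

definition field :: "'i set \<Rightarrow> ('i \<Rightarrow> real) \<Rightarrow> ('i discrete \<Rightarrow>\<^sub>C complex) \<Rightarrow> ('i discrete \<Rightarrow>\<^sub>C complex)" where
  "field I a w = from_coords I (velocity I a (coords w))"

lemma separated_subset_configurations:
  assumes "0 < \<epsilon>"
  shows "separated I \<epsilon> \<subseteq> configurations I"
proof
  fix w assume w: "w \<in> separated I \<epsilon>"
  have "0 < s (coords w i)" if "i \<in> I" for i
    using w that assms by (auto simp: separated_def)
  moreover have "0 < norm (coords w i - coords w j)" if "i \<in> I" "j \<in> I" "i \<noteq> j" for i j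
    using w that assms unfolding separated_def by force
  ultimately show "w \<in> configurations I"
    by (auto simp: configurations_def mem_iff)
qed

lemma configuration_separated:
  assumes I: "finite I" and w: "w \<in> configurations I"
  shows "\<exists>\<epsilon>>0. w \<in> separated I \<epsilon>"
proof -
  define \<epsilon> where "\<epsilon> = Min (insert 1 ((\<lambda>i. s (coords w i)) ` I
    \<union> (\<lambda>(i, j). norm (coords w i - coords w j)) ` {(i, j) \<in> I \<times> I. i \<noteq> j}))"
  have fin: "finite {(i, j) \<in> I \<times> I. i \<noteq> j}"
    using I by (auto intro: finite_subset[of _ "I \<times> I"])
  have "0 < \<epsilon>"
    unfolding \<epsilon>_def using I fin w by (subst Min_gr_iff) (auto simp: configurations_def s_pos)
  moreover have "\<epsilon> \<le> s (coords w i)" if "i \<in> I" for i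
    unfolding \<epsilon>_def using I fin that by (intro Min_le) auto
  moreover have "\<epsilon> \<le> norm (coords w i - coords w j)" if "i \<in> I" "j \<in> I" "i \<noteq> j" for i j
    unfolding \<epsilon>_def using I fin that by (intro Min_le) force+
  ultimately show ?thesis
    by (auto simp: separated_def)
qed

lemma separated_cball:
  assumes \<epsilon>: "0 < \<epsilon>" and w: "w \<in> separated I \<epsilon>"
  shows "cball w (min 1 (\<epsilon> / 8)) \<subseteq> separated I (\<epsilon> / 2)"
proof
  fix v assume v: "v \<in> cball w (min 1 (\<epsilon> / 8))"
  have near: "norm (coords w i - coords v i) \<le> min 1 (\<epsilon> / 8)" for i
    using v coords_dist[of w i v] by (simp add: dist_norm)
  have "\<epsilon> / 2 \<le> s (coords v i)" if i: "i \<in> I" for i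
  proof -
    have si: "\<epsilon> \<le> s (coords w i)"
      using w i by (simp add: separated_def)
    have "coords w i \<in> \<Omega>"
      using w i separated_subset_configurations[OF \<epsilon>] by (auto simp: configurations_def)
    then have "\<bar>s (coords w i) - s (coords v i)\<bar> \<le> (2 + norm (coords w i - coords v i)) * norm (coords w i - coords v i)"
      by (rule s_near)
    also have "\<dots> \<le> 3 * (\<epsilon> / 8)"
      using near[of i] by (intro mult_mono) auto
    finally show ?thesis
      using si by linarith
  qed
  moreover have "\<epsilon> / 2 \<le> norm (coords v i - coords v j)" if ij: "i \<in> I" "j \<in> I" "i \<noteq> j" for i j
  proof -
    have "\<epsilon> \<le> norm (coords w i - coords w j)"
      using w ij by (simp add: separated_def)
    also have "coords w i - coords w j = (coords w i - coords v i) + (coords v i - coords v j) + (coords v j - coords w j)"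
      by simp
    also have "norm \<dots> \<le> norm (coords w i - coords v i) + norm (coords v i - coords v j) + norm (coords v j - coords w j)"
      by (intro norm_triangle_mono) auto
    finally show ?thesis
      using near[of i] near[of j] \<epsilon> by (simp add: norm_minus_commute)
  qed
  ultimately show "v \<in> separated I (\<epsilon> / 2)"
    by (simp add: separated_def)
qed

lemma coords_field: "finite I \<Longrightarrow> coords (field I a w) i = (if i \<in> I then velocity I a (coords w) i else 0)"
  by (simp add: field_def coords_from_coords)

lemma lip_bdd_velocity:
  fixes I :: "'i set"
  assumes I: "finite I" and \<epsilon>: "0 < \<epsilon>" and i: "i \<in> I"
  shows "lip_bdd (separated I \<epsilon>) (\<lambda>w :: 'i discrete \<Rightarrow>\<^sub>C complex. velocity I a (coords w) i)"
proof -
  let ?S = "separated I \<epsilon>"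
  have dom: "coords w j \<in> \<Omega>" if "w \<in> ?S" "j \<in> I" for w j
    using that separated_subset_configurations[OF \<epsilon>] by (auto simp: configurations_def)
  have apply_le: "norm (coords v j - coords w j) \<le> dist v w" for v w :: "'i discrete \<Rightarrow>\<^sub>C complex" and j
    using coords_dist[of v j w] by (simp add: dist_norm)
  have direct: "lip_bdd ?S (\<lambda>w :: 'i discrete \<Rightarrow>\<^sub>C complex. 1 / cnj (coords w i - coords w j))" if "j \<in> I" "i \<noteq> j" for j
  proof (rule lip_bdd_inverse_cnj)
    show "2-lipschitz_on ?S (\<lambda>w :: 'i discrete \<Rightarrow>\<^sub>C complex. coords w i - coords w j)"
    proof (rule lipschitz_onI)
      fix v w :: "'i discrete \<Rightarrow>\<^sub>C complex"
      have "norm ((coords v i - coords v j) - (coords w i - coords w j)) \<le> norm (coords v i - coords w i) + norm (coords v j - coords w j)"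
        using norm_triangle_ineq4[of "coords v i - coords w i" "coords v j - coords w j"] by (simp add: algebra_simps)
      then show "dist (coords v i - coords v j) (coords w i - coords w j) \<le> 2 * dist v w"
        using apply_le[of v i w] apply_le[of v j w] by (simp add: dist_norm)
    qed simp
  qed (use \<epsilon> i that in \<open>auto simp: separated_def\<close>)
  have e: "lip_bdd ?S (\<lambda>w :: 'i discrete \<Rightarrow>\<^sub>C complex. e (coords w j))" if "j \<in> I" for j
  proof -
    have "1-lipschitz_on ?S (\<lambda>w :: 'i discrete \<Rightarrow>\<^sub>C complex. e (coords w j))"
    proof (rule lipschitz_onI)
      fix v w :: "'i discrete \<Rightarrow>\<^sub>C complex"
      show "dist (e (coords v j)) (e (coords w j)) \<le> 1 * dist v w"
        using order_trans[OF e_diff apply_le[of v j w]] by (simp add: dist_norm)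
    qed simp
    moreover have "norm (e (coords w j)) \<le> 1" if "w \<in> ?S" for w
      using norm_e dom \<open>j \<in> I\<close> that by blast
    ultimately show ?thesis
      unfolding lip_bdd_def by blast
  qed
  have image: "lip_bdd ?S (\<lambda>w :: 'i discrete \<Rightarrow>\<^sub>C complex. 1 / cnj (B (coords w i) (coords w j)))" if j: "j \<in> I" for j
  proof (rule lip_bdd_inverse_cnj)
    show "2-lipschitz_on ?S (\<lambda>w :: 'i discrete \<Rightarrow>\<^sub>C complex. B (coords w i) (coords w j))"
    proof (rule lipschitz_onI)
      fix v w assume "v \<in> ?S" "w \<in> ?S"
      then have "norm (B (coords v i) (coords v j) - B (coords w i) (coords w j)) \<le> norm (coords v i - coords w i) + norm (coords v j - coords w j)"
        using dom i j by (intro B_diff) auto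
      then show "dist (B (coords v i) (coords v j)) (B (coords w i) (coords w j)) \<le> 2 * dist v w"
        using apply_le[of v i w] apply_le[of v j w] by (simp add: dist_norm)
    qed simp
    show "\<epsilon> \<le> norm (B (coords w i) (coords w j))" if "w \<in> ?S" for w
    proof (rule power2_le_imp_le)
      have "\<epsilon>\<^sup>2 \<le> s (coords w i) * s (coords w j)"
        unfolding power2_eq_square using that i j \<epsilon> by (intro mult_mono) (auto simp: separated_def)
      then show "\<epsilon>\<^sup>2 \<le> (norm (B (coords w i) (coords w j)))\<^sup>2"
        using s_mult_le_norm_B order_trans by blast
    qed simp
  qed (rule \<epsilon>)
  have image': "lip_bdd ?S (\<lambda>w :: 'i discrete \<Rightarrow>\<^sub>C complex. e (coords w j) / cnj (B (coords w i) (coords w j)))" if "j \<in> I" for j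
    using lip_bdd_mult[OF e[OF that] image[OF that]] by simp
  have "lip_bdd ?S (\<lambda>w :: 'i discrete \<Rightarrow>\<^sub>C complex. pair_grad (coords w i) (coords w j))" if "j \<in> I" "i \<noteq> j" for j
    unfolding pair_grad_def
    using lip_bdd_add[OF direct[OF that] lip_bdd_scaleR[OF image'[OF that(1)], of "- 1"]]
    by (intro lip_bdd_scaleR) simp
  moreover have "lip_bdd ?S (\<lambda>w :: 'i discrete \<Rightarrow>\<^sub>C complex. self_grad (coords w i))"
    unfolding self_grad_def by (intro lip_bdd_scaleR image' i)
  ultimately show ?thesis
    unfolding velocity_def using I i
    by (intro lip_bdd_mult lip_bdd_const lip_bdd_add lip_bdd_sum lip_bdd_scaleR) auto
qed

lemma field_bounded_lipschitz:
  fixes I :: "'i set"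
  assumes I: "finite I" and \<epsilon>: "0 < \<epsilon>"
  shows "\<exists>M L. (\<forall>w\<in>separated I \<epsilon>. norm (field I a w) \<le> M) \<and> L-lipschitz_on (separated I \<epsilon>) (field I a)"
proof -
  let ?S = "separated I \<epsilon> :: ('i discrete \<Rightarrow>\<^sub>C complex) set"
  have "\<forall>i\<in>I. \<exists>M L. (\<forall>w\<in>?S. norm (velocity I a (coords w) i) \<le> M) \<and> L-lipschitz_on ?S (\<lambda>w :: 'i discrete \<Rightarrow>\<^sub>C complex. velocity I a (coords w) i)"
    using lip_bdd_velocity[OF I \<epsilon>] unfolding lip_bdd_def by blast
  then obtain M L where M: "\<And>i w. \<lbrakk>i \<in> I; w \<in> ?S\<rbrakk> \<Longrightarrow> norm (velocity I a (coords w) i) \<le> M i"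
    and L: "\<And>i. i \<in> I \<Longrightarrow> (L i)-lipschitz_on ?S (\<lambda>w :: 'i discrete \<Rightarrow>\<^sub>C complex. velocity I a (coords w) i)"
    by metis
  have L0: "0 \<le> L i" if "i \<in> I" for i
    using lipschitz_on_nonneg[OF L[OF that]] .
  have "norm (field I a w) \<le> (\<Sum>i\<in>I. \<bar>M i\<bar>)" if "w \<in> ?S" for w
  proof (rule norm_le_coords)
    fix i
    show "norm (coords (field I a w) i) \<le> (\<Sum>i\<in>I. \<bar>M i\<bar>)"
    proof (cases "i \<in> I")
      case True
      have "norm (velocity I a (coords w) i) \<le> \<bar>M i\<bar>"
        using M[OF True that] by simp
      also have "\<dots> \<le> (\<Sum>i\<in>I. \<bar>M i\<bar>)"
        using I True by (intro member_le_sum) auto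
      finally show ?thesis
        using True I by (simp add: coords_field)
    qed (simp add: coords_field I sum_nonneg)
  qed
  moreover have "(\<Sum>i\<in>I. L i)-lipschitz_on ?S (field I a)"
  proof (rule lipschitz_onI)
    fix v w assume vw: "v \<in> ?S" "w \<in> ?S"
    show "dist (field I a v) (field I a w) \<le> (\<Sum>i\<in>I. L i) * dist v w"
    proof (rule dist_le_coords)
      fix i
      show "dist (coords (field I a v) i) (coords (field I a w) i) \<le> (\<Sum>i\<in>I. L i) * dist v w"
      proof (cases "i \<in> I")
        case True
        have "dist (velocity I a (coords v) i) (velocity I a (coords w) i) \<le> L i * dist v w"
          using lipschitz_onD[OF L[OF True] vw] .
        also have "\<dots> \<le> (\<Sum>i\<in>I. L i) * dist v w"
          using I True L0 by (intro mult_right_mono member_le_sum) auto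
        finally show ?thesis
          using True I by (simp add: coords_field)
      qed (simp add: coords_field I sum_nonneg L0)
    qed
  qed (simp add: sum_nonneg L0)
  ultimately show ?thesis
    by blast
qed

lemma configuration_component_derivative:
  assumes sol: "ode_solution (field I a) U J X" and I: "finite I" and "i \<in> I" "t \<in> J"
  shows "((\<lambda>t. coords (X t) i) has_vector_derivative velocity I a (coords (X t)) i) (at t within J)"
proof -
  have "(X has_vector_derivative field I a (X t)) (at t within J)"
    using assms by (simp add: ode_solution_def)
  then show ?thesis
    using bounded_linear.has_vector_derivative[OF bounded_linear_coords, of X "field I a (X t)" "at t within J" i]
    by (simp add: coords_field assms)
qed

theorem global_vortex_motion:
  fixes I :: "'i set"
  assumes I: "finite I" and a: "\<And>i. i \<in> I \<Longrightarrow> 0 < a i"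
    and w0: "\<And>i. i \<in> I \<Longrightarrow> w0 i \<in> \<Omega>" and inj: "inj_on w0 I"
  shows "\<exists>z. (\<forall>i\<in>I. z i 0 = w0 i) \<and> (\<forall>t\<ge>0. (\<forall>i\<in>I. z i t \<in> \<Omega>) \<and> inj_on (\<lambda>i. z i t) I)
    \<and> (\<forall>t\<ge>0. \<forall>i\<in>I. (z i has_vector_derivative velocity I a (\<lambda>j. z j t) i) (at t within {0..}))"
proof -
  define W where "W = from_coords I w0"
  have W: "coords W i = (if i \<in> I then w0 i else 0)" for i
    by (simp add: W_def coords_from_coords I)
  have "\<exists>X. X 0 = W \<and> ode_solution (field I a) (configurations I) {0..} X"
  proof (rule ode_global_solution_if_trapped[where K = "separated I"])
    show "W \<in> configurations I"
      using w0 inj by (auto simp: configurations_def W inj_on_def)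
    show "\<exists>\<epsilon>>0. w \<in> separated I \<epsilon>" if "w \<in> configurations I" for w
      using configuration_separated[OF I that] .
    show "\<exists>r>0. \<exists>M L. \<forall>w\<in>separated I \<epsilon>. cball w r \<subseteq> configurations I \<and>
        (\<forall>v\<in>cball w r. norm (field I a v) \<le> M) \<and> L-lipschitz_on (cball w r) (field I a)"
      if \<epsilon>: "0 < \<epsilon>" for \<epsilon>
    proof -
      obtain M L where M: "\<forall>w\<in>separated I (\<epsilon> / 2). norm (field I a w) \<le> M"
        and L: "L-lipschitz_on (separated I (\<epsilon> / 2)) (field I a)"
        using field_bounded_lipschitz[OF I, of "\<epsilon> / 2" a] \<epsilon> by auto
      have "cball w (min 1 (\<epsilon> / 8)) \<subseteq> configurations I \<and>
          (\<forall>v\<in>cball w (min 1 (\<epsilon> / 8)). norm (field I a v) \<le> M) \<and>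
          L-lipschitz_on (cball w (min 1 (\<epsilon> / 8))) (field I a)" if w: "w \<in> separated I \<epsilon>" for w
      proof -
        have "separated I (\<epsilon> / 2) \<subseteq> configurations I"
          using \<epsilon> by (intro separated_subset_configurations) simp
        then show ?thesis
          using separated_cball[OF \<epsilon> w] M lipschitz_on_subset[OF L separated_cball[OF \<epsilon> w]] by blast
      qed
      moreover have "0 < min 1 (\<epsilon> / 8)"
        using \<epsilon> by simp
      ultimately show ?thesis
        by blast
    qed
    fix T :: real and X
    assume T: "0 < T" and X0: "X 0 = W" and sol: "ode_solution (field I a) (configurations I) {0..<T} X"
    interpret motion: vortex_motion \<Omega> s g e B \<kappa> I a "\<lambda>i t. coords (X t) i" T
    proof
      show "coords (X t) i \<in> \<Omega>" if "i \<in> I" "t \<in> {0..<T}" for i t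
        using sol that by (auto simp: ode_solution_def configurations_def)
      show "coords (X t) i \<noteq> coords (X t) j"
        if "i \<in> I" "j \<in> I" "i \<noteq> j" "t \<in> {0..<T}" for i j t
        using sol that unfolding ode_solution_def configurations_def by blast
      show "((\<lambda>t. coords (X t) i) has_vector_derivative
          velocity I a (\<lambda>j. coords (X t) j) i) (at t within {0..<T})"
        if "i \<in> I" "t \<in> {0..<T}" for i t
        using configuration_component_derivative[OF sol I that] .
    qed (use I a T in auto)
    obtain \<delta>1 \<delta>2 where "0 < \<delta>1" "\<forall>i\<in>I. \<forall>t\<in>{0..<T}. \<delta>1 \<le> s (coords (X t) i)"
      "0 < \<delta>2" "\<forall>i\<in>I. \<forall>j\<in>I. \<forall>t\<in>{0..<T}. i \<noteq> j \<longrightarrow> \<delta>2 \<le> norm (coords (X t) i - coords (X t) j)"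
      using motion.height_bounded_below motion.distance_bounded_below by blast
    then show "\<exists>\<epsilon>>0. \<forall>t\<in>{0..<T}. X t \<in> separated I \<epsilon>"
      by (intro exI[of _ "min \<delta>1 \<delta>2"]) (auto simp: separated_def min_le_iff_disj)
  qed
  then obtain X where X0: "X 0 = W" and sol: "ode_solution (field I a) (configurations I) {0..} X"
    by blast
  have "X t \<in> configurations I" if "0 \<le> t" for t
    using sol that by (simp add: ode_solution_def)
  then show ?thesis
    using configuration_component_derivative[OF sol I]
    by (intro exI[of _ "\<lambda>i t. coords (X t) i"])
      (auto simp: X0 W configurations_def inj_on_def)
qed

end

section \<open>The half-plane and the unit disk\<close>

lemma grad_perp_eqI:
  assumes "((\<lambda>t. f (Complex (Re x) t)) has_real_derivative inner w \<i>) (at (Im x))"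
    and "((\<lambda>t. f (Complex t (Im x))) has_real_derivative inner w 1) (at (Re x))"
  shows "grad_perp f x = \<i> * w"
  using assms[THEN DERIV_imp_deriv] by (simp add: grad_perp_def complex_eq_iff inner_complex_def)

lemma vertical_line_derivative: "((\<lambda>t. Complex c t) has_vector_derivative \<i>) (at t)"
  and horizontal_line_derivative: "((\<lambda>t. Complex t c) has_vector_derivative 1) (at t)"
  unfolding Complex_eq has_vector_derivative_def
  by (auto intro!: derivative_eq_intros simp: scaleR_conv_of_real)

context vortex_domain
begin

lemma grad_perp_green:
  assumes "x \<in> \<Omega>" "y \<in> \<Omega>" "x \<noteq> y"
  shows "grad_perp (\<lambda>z. green z y) x = \<i> * pair_grad x y"
proof (rule grad_perp_eqI)
  show "((\<lambda>t. green (Complex (Re x) t) y) has_real_derivative inner (pair_grad x y) \<i>) (at (Im x))"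
    using green_curve_derivative[OF vertical_line_derivative[of "Re x" "Im x"] has_vector_derivative_const, of y] assms
    by simp
  show "((\<lambda>t. green (Complex t (Im x)) y) has_real_derivative inner (pair_grad x y) 1) (at (Re x))"
    using green_curve_derivative[OF horizontal_line_derivative[of "Im x" "Re x"] has_vector_derivative_const, of y] assms
    by simp
qed

lemma grad_perp_robin:
  assumes x: "x \<in> \<Omega>" and R: "\<And>y. y \<in> \<Omega> \<Longrightarrow> R y = robin_fun y"
  shows "grad_perp R x = \<i> * self_grad x"
proof -
  have along: "((\<lambda>t. R (c t)) has_real_derivative inner (self_grad x) c') (at t)"
    if c: "(c has_vector_derivative c') (at t)" and t: "c t = x" for c c' t
  proof -
    have "(c \<longlongrightarrow> x) (at t)"
      using has_vector_derivative_continuous[OF c] t by (simp add: continuous_at)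
    then have "\<forall>\<^sub>F u in at t. c u \<in> \<Omega>"
      using open_domain x by (rule topological_tendstoD)
    then have "\<forall>\<^sub>F u in at t. robin_fun (c u) = R (c u)"
      by eventually_elim (simp add: R)
    moreover have "((\<lambda>t. robin_fun (c t)) has_real_derivative inner (self_grad x) c') (at t)"
      using robin_curve_derivative[OF c] x t by simp
    ultimately show ?thesis
      using R[OF x] t unfolding has_field_derivative_def
      by (auto intro: has_derivative_transform_eventually)
  qed
  show ?thesis
    by (rule grad_perp_eqI; rule along[OF vertical_line_derivative] along[OF horizontal_line_derivative]) auto
qed

theorem global_point_vortex_solution_exists:
  assumes "\<forall>i\<in>{1..N}. a i > 0" "\<forall>i\<in>{1..N}. x0 i \<in> \<Omega>" "inj_on x0 {1..N}"
    and G: "G = green" and R: "\<And>x. x \<in> \<Omega> \<Longrightarrow> robin G x = robin_fun x"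
  shows "\<exists>x. global_point_vortex_solution \<Omega> G N a x0 x"
proof -
  obtain z where z0: "\<forall>i\<in>{1..N}. z i 0 = x0 i"
    and dom: "\<forall>t\<ge>0. (\<forall>i\<in>{1..N}. z i t \<in> \<Omega>) \<and> inj_on (\<lambda>i. z i t) {1..N}"
    and deriv: "\<forall>t\<ge>0. \<forall>i\<in>{1..N}.
      (z i has_vector_derivative velocity {1..N} a (\<lambda>j. z j t) i) (at t within {0..})"
    using global_vortex_motion[of "{1..N}" a x0] assms by auto
  have "velocity {1..N} a (\<lambda>j. z j t) i = (\<Sum>j\<in>{1..N} - {i}. a j *\<^sub>R grad_perp (\<lambda>x. G x (z j t)) (z i t))
      + (a i / 2) *\<^sub>R grad_perp (robin G) (z i t)" if t: "0 \<le> t" and i: "i \<in> {1..N}" for t i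
  proof -
    have "grad_perp (\<lambda>x. G x (z j t)) (z i t) = \<i> * pair_grad (z i t) (z j t)" if "j \<in> {1..N} - {i}" for j
    proof -
      have "z i t \<noteq> z j t"
        using dom t i that inj_on_eq_iff[of "\<lambda>i. z i t" "{1..N}" i j] by auto
      then show ?thesis
        unfolding G using dom t i that by (intro grad_perp_green) auto
    qed
    moreover have "grad_perp (robin G) (z i t) = \<i> * self_grad (z i t)"
      using dom t i R by (intro grad_perp_robin) auto
    ultimately show ?thesis
      by (simp add: velocity_def distrib_left sum_distrib_left)
  qed
  then show ?thesis
    unfolding global_point_vortex_solution_def using z0 dom deriv by (intro exI[of _ z]) auto
qed

end

lemma vortex_domain_half_plane:
  "vortex_domain half_plane (\<lambda>x. 2 * Im x) (\<lambda>_. 2 * \<i>) (\<lambda>_. 1) (\<lambda>x y. x - cnj y) 0"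
proof
  fix x y x' y' :: complex
  show "x \<in> half_plane \<longleftrightarrow> 0 < 2 * Im x"
    by (simp add: half_plane_def)
  show "(norm (x - cnj y))\<^sup>2 = (norm (x - y))\<^sup>2 + 2 * Im x * (2 * Im y)"
    unfolding cmod_power2 by (simp add: power2_eq_square algebra_simps)
  show "((\<lambda>x. 2 * Im x) has_derivative inner (2 * \<i>)) (at x)"
    by (auto intro!: derivative_eq_intros simp: inner_complex_def)
  show "\<bar>2 * Im x - 2 * Im y\<bar> \<le> (norm (2 * \<i>) + norm (2 * \<i>)) / 2 * norm (x - y)"
    using abs_Im_le_cmod[of "x - y"] by simp
  show "2 * (x - y) + (2 * Im y) *\<^sub>R (2 * \<i>) = 2 * 1 * (x - cnj y)"
    by (simp add: complex_eq_iff)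
  have "x - cnj y - (x' - cnj y') = (x - x') - cnj (y - y')"
    by simp
  also have "norm \<dots> \<le> norm (x - x') + norm (cnj (y - y'))"
    by (rule norm_triangle_ineq4)
  finally show "norm (x - cnj y - (x' - cnj y')) \<le> norm (x - x') + norm (y - y')"
    by (simp only: complex_mod_cnj)
qed auto

lemma vortex_domain_unit_disk:
  "vortex_domain unit_disk (\<lambda>x. 1 - (norm x)\<^sup>2) (\<lambda>x. - 2 * x) (\<lambda>x. x) (\<lambda>x y. x * cnj y - 1) 1"
proof
  fix x y x' y' :: complex
  show "x \<in> unit_disk \<longleftrightarrow> 0 < 1 - (norm x)\<^sup>2"
    by (simp add: unit_disk_def abs_square_less_1)
  show "(norm (x * cnj y - 1))\<^sup>2 = (norm (x - y))\<^sup>2 + (1 - (norm x)\<^sup>2) * (1 - (norm y)\<^sup>2)"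
    unfolding cmod_power2 by (simp add: power2_eq_square algebra_simps)
  have "((\<lambda>x. 1 - inner x x) has_derivative (\<lambda>h. 0 - (inner x h + inner h x))) (at x)"
    by (intro has_derivative_diff has_derivative_inner has_derivative_const has_derivative_ident)
  moreover have "(\<lambda>h. 0 - (inner x h + inner h x)) = inner (- 2 * x)"
    by (simp add: fun_eq_iff inner_complex_def)
  ultimately show "((\<lambda>x. 1 - (norm x)\<^sup>2) has_derivative inner (- 2 * x)) (at x)"
    by (simp only: power2_norm_eq_inner)
  have "\<bar>(1 - (norm x)\<^sup>2) - (1 - (norm y)\<^sup>2)\<bar> = \<bar>(norm x + norm y) * (norm x - norm y)\<bar>"
    by (simp add: power2_eq_square algebra_simps)
  also have "\<dots> \<le> (norm x + norm y) * norm (x - y)"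
    by (simp add: abs_mult mult_left_mono norm_triangle_ineq3)
  also have "norm x + norm y = (norm (- 2 * x) + norm (- 2 * y)) / 2"
    by (simp add: norm_mult)
  finally show "\<bar>(1 - (norm x)\<^sup>2) - (1 - (norm y)\<^sup>2)\<bar> \<le> (norm (- 2 * x) + norm (- 2 * y)) / 2 * norm (x - y)" .
  show "- 2 * x - - 2 * y = - (2 * 1) *\<^sub>R (x - y)"
    by (simp add: scaleR_conv_of_real algebra_simps)
  show "2 * (x - y) + (1 - (norm y)\<^sup>2) *\<^sub>R (- 2 * x) = 2 * y * (x * cnj y - 1)"
    by (simp add: scaleR_conv_of_real complex_norm_square algebra_simps del: of_real_power)
  show "x \<in> unit_disk \<Longrightarrow> norm (- 2 * x) \<le> 2"
    by (simp add: unit_disk_def norm_mult)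
  assume "x \<in> unit_disk" "y \<in> unit_disk" "x' \<in> unit_disk" "y' \<in> unit_disk"
  then have "norm y \<le> 1" "norm x' \<le> 1"
    by (auto simp: unit_disk_def)
  have "x * cnj y - 1 - (x' * cnj y' - 1) = (x - x') * cnj y + x' * cnj (y - y')"
    by (simp add: algebra_simps)
  also have "norm \<dots> \<le> norm ((x - x') * cnj y) + norm (x' * cnj (y - y'))"
    by (rule norm_triangle_ineq)
  also have "\<dots> \<le> norm (x - x') + norm (y - y')"
    using \<open>norm y \<le> 1\<close> \<open>norm x' \<le> 1\<close> unfolding norm_mult complex_mod_cnj
    by (intro add_mono mult_left_le mult_left_le_one_le) auto
  finally show "norm (x * cnj y - 1 - (x' * cnj y' - 1)) \<le> norm (x - x') + norm (y - y')" .
qed (auto simp: unit_disk_def)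

theorem theorem2p1:
  fixes \<Omega> :: "complex set"
    and G :: "complex \<Rightarrow> complex \<Rightarrow> real"
    and N :: nat
    and a :: "nat \<Rightarrow> real"
    and x0 :: "nat \<Rightarrow> complex"
  assumes "(\<Omega> = half_plane \<and> G = green_half_plane) \<or> (\<Omega> = unit_disk \<and> G = green_disk)"
    and "N \<ge> 1"
    and "\<forall>i\<in>{1..N}. a i > 0"
    and "\<forall>i\<in>{1..N}. x0 i \<in> \<Omega>"
    and "inj_on x0 {1..N}"
  shows "\<exists>x. global_point_vortex_solution \<Omega> G N a x0 x"
  using assms(1)
proof
  assume H: "\<Omega> = half_plane \<and> G = green_half_plane"
  interpret vortex_domain half_plane "\<lambda>x. 2 * Im x" "\<lambda>_. 2 * \<i>" "\<lambda>_. 1" "\<lambda>x y. x - cnj y" 0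
    by (rule vortex_domain_half_plane)
  have "green_half_plane = green"
    by (simp add: fun_eq_iff green_half_plane_def green_def)
  then show ?thesis
    using global_point_vortex_solution_exists[of N a x0 G] H assms(3-5)
    by (simp add: robin_half_plane robin_fun_def)
next
  assume D: "\<Omega> = unit_disk \<and> G = green_disk"
  interpret vortex_domain unit_disk "\<lambda>x. 1 - (norm x)\<^sup>2" "\<lambda>x. - 2 * x" "\<lambda>x. x" "\<lambda>x y. x * cnj y - 1" 1
    by (rule vortex_domain_unit_disk)
  have "green_disk = green"
    by (simp add: fun_eq_iff green_disk_def green_def)
  then show ?thesis
    using global_point_vortex_solution_exists[of N a x0 G] D assms(3-5)
    by (simp add: robin_disk robin_fun_def)
qed

end
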